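(* Let $G<\operatorname{Aut}(T_d)$ be a contracting self-similar regular branch group acting on the $d$-ary rooted tree $T_d$, generated by a finite symmetric set $S$ that contains the nucleus $\mathcal N$ of $G$, and let $\mathcal NG$ be the contracting closure of $G$. There is an algorithm that, given the nucleus portrait of an element $g\in\mathcal NG$ of depth $t$, decides whether $g\in G$ and in this case constructs a word in $S$ of length exponential in $t$, representing $g$. The complexity of this algorithm is exponential in $t$.
   Context: Let $X$ be an alphabet with $d$ letters. $T_d$ is identified with the set $X^*$ of finite words over $X$ ($v$ is adjacent to $vx$; the root is the empty word; level $n$ is $X^n$), and $\operatorname{Aut}(T_d)$ is its group of rooted tree automorphisms. Actions are right actions: $gh(y)=h(g(y))$. For $g\in\operatorname{Aut}(T_d)$ and $v\in X^*$, the section $g|_v$ is the automorphism defined by $g(vw)=g(v)\,g|_v(w)$ for all $w\in X^*$. A group $G<\operatorname{Aut}(T_d)$ is self-similar if $g|_x\in G$ for all $g\in G$, $x\in X$. A self-similar group $G$ is contracting if there is a finite set $\mathcal N\subset G$ such that for each $g\in G$ there is $l\ge 0$ with $g|_v\in\mathcal N$ for all $v\in X^k$ and all $k\ge l$; the minimal such $\mathcal N$ is the nucleus of $G$. The contracting closure of $G$ is the subgroup $$\mathcal NG=\{g\in\operatorname{Aut}(T_d)\mid \exists N\ge 1 \text{ such that } \forall v\in X^N:\ g|_v\in\mathcal N\}$$ of $\operatorname{Aut}(T_d)$. For $g\in\mathcal NG$ the nucleus portrait $\pi(g)$ is the finite labeled rooted tree defined recursively: if $g\in\mathcal N$, it is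 a single vertex labeled by $g$; otherwise it consists of a root labeled by the permutation of $X$ induced by $g$ on the first level, with $d$ children (indexed by $x\in X$) that are the roots of the nucleus portraits of $g|_x$, $x\in X$. Its depth is the maximal distance from the root to a leaf (so it is $0$ for $g\in\mathcal N$). Let $\operatorname{St}_G(1)$ be the stabilizer of the first level in $G$ (the elements fixing every vertex of level $1$), and let $\Psi:\operatorname{St}_G(1)\hookrightarrow G^d$ be the embedding sending $g$ to the tuple of its sections at the vertices of the first level. A self-similar group $G$ is a regular branch group over a nontrivial subgroup $K\le G$ if $G$ acts transitively on each level of $X^*$, $K^d\le\Psi(\operatorname{St}_G(1)\cap K)$, $[G:K]<\infty$, and $[\Psi(\operatorname{St}_G(1)\cap K):K^d]<\infty$. $G$ is a regular branch group if it is so over some such $K$. The group $G$ and the set $S$ are fixed; only the nucleus portrait is the input of the algorithm, and "exponential in $t$" means bounded above by $A\cdot B^t$ for constants $A,B$ depending only on $G$ and $S$. *)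

theory Defs
  imports "HOL-Algebra.Product_Groups" "HOL-Algebra.Generated_Groups"
begin

section \<open>Automorphisms of the rooted tree\<close>

text \<open>The alphabet is a finite type 'x, so d = CARD('x); the vertices of the tree are all
  words of type 'x list.\<close>

type_synonym 'x tree_map = "'x list \<Rightarrow> 'x list"

definition adjacent :: "'x list \<Rightarrow> 'x list \<Rightarrow> bool" where
  "adjacent v w \<longleftrightarrow> (\<exists>x. w = v @ [x]) \<or> (\<exists>x. v = w @ [x])"

definition tree_auts :: "'x tree_map set" where
  "tree_auts = {g. bij g \<and> g [] = [] \<and> (\<forall>v w. adjacent (g v) (g w) \<longleftrightarrow> adjacent v w)}"

text \<open>Right actions: the product of g and h maps y to h (g y).\<close>

definition AutT :: "'x tree_map monoid" where
  "AutT = \<lparr>carrier = tree_auts, mult = (\<lambda>g h. h \<circ> g), one = id\<rparr>"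

text \<open>The defining property g (v @ w) = g v @ section_at g v w is lemma section_spec below.\<close>

definition section_at :: "'x tree_map \<Rightarrow> 'x list \<Rightarrow> 'x tree_map" where
  "section_at g v = (\<lambda>w. drop (length (g v)) (g (v @ w)))"

definition root_perm :: "'x tree_map \<Rightarrow> 'x \<Rightarrow> 'x" where
  "root_perm g x = hd (g [x])"

lemma group_AutT: "group AutT"
proof (rule groupI)
  fix x :: "'a tree_map" assume x: "x \<in> carrier AutT"
  then have b: "bij x" by (simp add: AutT_def tree_auts_def)
  have f: "x (inv_into UNIV x y) = y" for y
    using b by (simp add: bij_is_surj surj_f_inv_f)
  have "inv_into UNIV x \<in> tree_auts"
    unfolding tree_auts_def
  proof (intro CollectI conjI allI)
    show "bij (inv_into UNIV x)" using b by (rule bij_imp_bij_inv)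
    show "inv_into UNIV x [] = []"
      using x b inv_f_f[of x "[]"] by (auto simp: AutT_def tree_auts_def bij_def)
    fix v w
    have "adjacent (x (inv_into UNIV x v)) (x (inv_into UNIV x w)) \<longleftrightarrow>
        adjacent (inv_into UNIV x v) (inv_into UNIV x w)"
      using x by (simp add: AutT_def tree_auts_def)
    then show "adjacent (inv_into UNIV x v) (inv_into UNIV x w) \<longleftrightarrow> adjacent v w"
      unfolding f by simp
  qed
  moreover have "x \<circ> inv_into UNIV x = id" using f by auto
  ultimately show "\<exists>y\<in>carrier AutT. y \<otimes>\<^bsub>AutT\<^esub> x = \<one>\<^bsub>AutT\<^esub>"
    by (intro bexI[of _ "inv_into UNIV x"]) (simp_all add: AutT_def)
qed (auto simp: AutT_def tree_auts_def bij_comp comp_assoc)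

lemma tree_aut_snoc:
  assumes "g \<in> tree_auts"
  shows "length (g v) = length v \<and> (\<exists>y. g (v @ [x]) = g v @ [y])"
proof (induction v arbitrary: x rule: rev_induct)
  case Nil
  have "adjacent [] [x]" by (simp add: adjacent_def)
  then have g0: "g [] = []" and "adjacent (g []) (g [x])"
    using assms by (simp_all add: tree_auts_def) (metis)
  then show ?case by (auto simp: adjacent_def)
next
  case (snoc a v)
  from snoc obtain y where y: "g (v @ [a]) = g v @ [y]" and l: "length (g v) = length v" by blast
  have "adjacent (v @ [a]) (v @ [a, x])" by (simp add: adjacent_def)
  then have "adjacent (g (v @ [a])) (g (v @ [a, x]))"
    using assms by (simp add: tree_auts_def)
  moreover have False if "g (v @ [a]) = g (v @ [a, x]) @ [z]" for z
  proof -
    have "g v = g (v @ [a, x])" using that y by simp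
    then have "v = v @ [a, x]" using assms by (auto simp: tree_auts_def bij_def dest: injD)
    then show False by simp
  qed
  ultimately show ?case using y l by (auto simp: adjacent_def)
qed

lemma tree_aut_length: "g \<in> tree_auts \<Longrightarrow> length (g v) = length v"
  by (simp add: tree_aut_snoc)

lemma section_spec:
  assumes "g \<in> tree_auts"
  shows "g (v @ w) = g v @ section_at g v w"
proof -
  have "\<exists>u. g (v @ w) = g v @ u"
  proof (induction w rule: rev_induct)
    case (snoc x w)
    then show ?case using tree_aut_snoc[OF assms, of "v @ w" x] by auto
  qed simp
  then show ?thesis by (auto simp: section_at_def)
qed

lemma section_Nil [simp]: "g \<in> tree_auts \<Longrightarrow> section_at g [] = g"
  by (auto simp: section_at_def tree_auts_def)

lemma section_append:
  assumes "g \<in> tree_auts"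
  shows "section_at g (v @ w) = section_at (section_at g v) w"
proof
  fix u
  have "section_at g v (w @ u) = section_at g v w @ section_at g (v @ w) u"
    using section_spec[OF assms, of "v @ w" u] section_spec[OF assms, of v w]
      section_spec[OF assms, of v "w @ u"] by simp
  then show "section_at g (v @ w) u = section_at (section_at g v) w u"
    by (simp add: section_at_def[of "section_at g v" w])
qed

section \<open>Self-similar, contracting and regular branch groups\<close>

definition self_similar :: "'x tree_map set \<Rightarrow> bool" where
  "self_similar G \<longleftrightarrow> subgroup G AutT \<and> (\<forall>g\<in>G. \<forall>x. section_at g [x] \<in> G)"

definition absorbing :: "'x tree_map set \<Rightarrow> 'x tree_map set \<Rightarrow> bool" where
  "absorbing G N \<longleftrightarrow> finite N \<and> N \<subseteq> G \<and>
     (\<forall>g\<in>G. \<exists>l. \<forall>v. l \<le> length v \<longrightarrow> section_at g v \<in> N)"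

definition contracting :: "'x tree_map set \<Rightarrow> bool" where
  "contracting G \<longleftrightarrow> self_similar G \<and> (\<exists>N. absorbing G N)"

text \<open>Least with respect to inclusion; it exists for contracting G by lemma nucleus_least.\<close>

definition nucleus :: "'x tree_map set \<Rightarrow> 'x tree_map set" where
  "nucleus G = (LEAST N. absorbing G N)"

lemma nucleus_least:
  assumes "contracting G"
  shows "absorbing G (nucleus G)" and "absorbing G M \<Longrightarrow> nucleus G \<subseteq> M"
proof -
  have inter: "absorbing G (A \<inter> B)" if A: "absorbing G A" and B: "absorbing G B" for A B
    unfolding absorbing_def
  proof (intro conjI ballI)
    fix g assume g: "g \<in> G"
    from A g obtain l where "\<forall>v. l \<le> length v \<longrightarrow> section_at g v \<in> A"
      unfolding absorbing_def by meson
    moreover from B g obtain m where "\<forall>v. m \<le> length v \<longrightarrow> section_at g v \<in> B"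
      unfolding absorbing_def by meson
    ultimately have "\<forall>v. max l m \<le> length v \<longrightarrow> section_at g v \<in> A \<inter> B" by auto
    then show "\<exists>l. \<forall>v. l \<le> length v \<longrightarrow> section_at g v \<in> A \<inter> B" by blast
  qed (use A B in \<open>auto simp: absorbing_def\<close>)
  obtain N where N: "absorbing G N" "\<And>M. absorbing G M \<Longrightarrow> card N \<le> card M"
    using assms ex_has_least_nat[of "absorbing G" _ card] unfolding contracting_def by metis
  have least: "N \<subseteq> M" if "absorbing G M" for M
  proof -
    have "finite N" using N(1) by (simp add: absorbing_def)
    then have "N \<inter> M = N" using N(2)[OF inter[OF N(1) that]] by (intro card_seteq) auto
    then show ?thesis by blast
  qed
  have "nucleus G = N" unfolding nucleus_def using N(1) least by (intro Least_equality)
  then show "absorbing G (nucleus G)" "absorbing G M \<Longrightarrow> nucleus G \<subseteq> M"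
    using N(1) least by auto
qed

definition contracting_closure :: "'x tree_map set \<Rightarrow> 'x tree_map set" where
  "contracting_closure G =
     {g \<in> tree_auts. \<exists>n\<ge>1. \<forall>v. length v = n \<longrightarrow> section_at g v \<in> nucleus G}"

definition level1_stabilizer :: "'x tree_map set \<Rightarrow> 'x tree_map set" where
  "level1_stabilizer G = {g \<in> G. \<forall>x. g [x] = [x]}"

definition Psi :: "'x tree_map \<Rightarrow> 'x \<Rightarrow> 'x tree_map" where
  "Psi g = (\<lambda>x. section_at g [x])"

definition level_transitive :: "'x tree_map set \<Rightarrow> bool" where
  "level_transitive G \<longleftrightarrow> (\<forall>v w. length v = length w \<longrightarrow> (\<exists>g\<in>G. g v = w))"

definition finite_index :: "('a, 'b) monoid_scheme \<Rightarrow> 'a set \<Rightarrow> 'a set \<Rightarrow> bool" where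
  "finite_index P L H \<longleftrightarrow> finite (rcosets\<^bsub>P\<lparr>carrier := L\<rparr>\<^esub> H)"

text \<open>The power of K is taken inside the product of copies of AutT indexed by the alphabet.\<close>

definition regular_branch_over :: "'x tree_map set \<Rightarrow> 'x tree_map set \<Rightarrow> bool" where
  "regular_branch_over G K \<longleftrightarrow>
     subgroup K AutT \<and> K \<subseteq> G \<and> K \<noteq> {\<one>\<^bsub>AutT\<^esub>} \<and>
     level_transitive G \<and>
     (\<Pi>\<^sub>E x\<in>UNIV. K) \<subseteq> Psi ` (level1_stabilizer G \<inter> K) \<and>
     finite_index AutT G K \<and>
     finite_index (product_group UNIV (\<lambda>_. AutT))
       (Psi ` (level1_stabilizer G \<inter> K)) (\<Pi>\<^sub>E x\<in>UNIV. K)"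

definition regular_branch :: "'x tree_map set \<Rightarrow> bool" where
  "regular_branch G \<longleftrightarrow> self_similar G \<and> (\<exists>K. regular_branch_over G K)"

definition word_value :: "'x tree_map list \<Rightarrow> 'x tree_map" where
  "word_value w = foldr (\<otimes>\<^bsub>AutT\<^esub>) w \<one>\<^bsub>AutT\<^esub>"

section \<open>Nucleus portraits\<close>

datatype 'x portrait = Leaf "'x tree_map" | Node "'x \<Rightarrow> 'x" "'x \<Rightarrow> 'x portrait"

primrec depth :: "('x::finite) portrait \<Rightarrow> nat" where
  "depth (Leaf g) = 0"
| "depth (Node s c) = Suc (Max (range (\<lambda>x. depth (c x))))"

inductive nucleus_portrait :: "'x tree_map set \<Rightarrow> 'x tree_map \<Rightarrow> 'x portrait \<Rightarrow> bool"
  for G where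
  leaf: "g \<in> nucleus G \<Longrightarrow> nucleus_portrait G g (Leaf g)"
| node: "g \<notin> nucleus G \<Longrightarrow> (\<And>x. nucleus_portrait G (section_at g [x]) (c x)) \<Longrightarrow>
    nucleus_portrait G g (Node (root_perm g) c)"

lemma nucleus_portrait_unique:
  "nucleus_portrait G g p \<Longrightarrow> nucleus_portrait G g q \<Longrightarrow> p = q"
proof (induction arbitrary: q rule: nucleus_portrait.induct)
  case (leaf g)
  then show ?case by (auto elim: nucleus_portrait.cases)
next
  case (node g c)
  from node.prems node.hyps(1) obtain c' where
    "q = Node (root_perm g) c'" "\<And>x. nucleus_portrait G (section_at g [x]) (c' x)"
    by (cases rule: nucleus_portrait.cases) auto
  with node.IH show ?case by auto
qed

lemma section_in_tree_auts:
  assumes g: "g \<in> tree_auts"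
  shows "section_at g v \<in> tree_auts"
proof -
  have "inj g" using g by (simp add: tree_auts_def bij_def)
  then have inj: "section_at g v u = section_at g v w \<longleftrightarrow> u = w" for u w
    using section_spec[OF g, of v u] section_spec[OF g, of v w] by (metis injD same_append_eq)
  have len: "length (section_at g v w) = length w" for w
    using section_spec[OF g, of v w] tree_aut_length[OF g]
    by (metis add_left_cancel length_append)
  have ex: "\<exists>w. section_at g v w = u" for u
  proof -
    obtain z where z: "g z = g v @ u" using g by (metis (mono_tags, lifting) bij_pointE mem_Collect_eq tree_auts_def)
    define a where "a = take (length v) z"
    have "length z = length v + length u" using z tree_aut_length[OF g] by (metis length_append)
    then have la: "length a = length v" by (simp add: a_def)
    have "g z = g a @ section_at g a (drop (length v) z)"
      using section_spec[OF g, of a "drop (length v) z"] by (simp add: a_def)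
    then have "g a = g v" using z la tree_aut_length[OF g] by (metis append_eq_append_conv)
    then have "a = v" using g by (auto simp: tree_auts_def bij_def inj_eq)
    then have "z = v @ drop (length v) z" by (metis a_def append_take_drop_id)
    then show ?thesis using z section_spec[OF g, of v] by (metis same_append_eq)
  qed
  then have bij: "bij (section_at g v)" 
    unfolding bij_def inj_def surj_def using inj by metis
  have "adjacent (section_at g v u) (section_at g v w) \<longleftrightarrow> adjacent (g (v @ u)) (g (v @ w))" for u w
    by (auto simp: adjacent_def section_spec[OF g])
  moreover have "adjacent (v @ u) (v @ w) \<longleftrightarrow> adjacent u w" for u w
    by (auto simp: adjacent_def)
  ultimately show ?thesis using g bij len[of "[]"] by (auto simp: tree_auts_def)
qed

lemma nucleus_portrait_exists:
  assumes "g \<in> contracting_closure G"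
  shows "\<exists>!p. nucleus_portrait G g p"
proof -
  have "g \<in> tree_auts \<Longrightarrow> (\<And>v. length v = n \<Longrightarrow> section_at g v \<in> nucleus G) \<Longrightarrow>
      \<exists>p. nucleus_portrait G g p" for n g
  proof (induction n arbitrary: g)
    case 0
    then show ?case using nucleus_portrait.leaf[of g G] by auto
  next
    case (Suc n)
    have "\<exists>p. nucleus_portrait G (section_at g [x]) p" for x
    proof (rule Suc.IH)
      show "section_at g [x] \<in> tree_auts" using Suc.prems(1) by (rule section_in_tree_auts)
      show "section_at (section_at g [x]) v \<in> nucleus G" if "length v = n" for v
        using Suc.prems(2)[of "[x] @ v"] section_append[OF Suc.prems(1), of "[x]" v] that by simp
    qed
    then obtain c where "\<And>x. nucleus_portrait G (section_at g [x]) (c x)" by metis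
    then show ?case 
      using nucleus_portrait.leaf[of g G] nucleus_portrait.node[of g G c] by metis
  qed
  moreover obtain n where "g \<in> tree_auts" "\<And>v. length v = n \<Longrightarrow> section_at g v \<in> nucleus G"
    using assms by (auto simp: contracting_closure_def)
  ultimately obtain p where "nucleus_portrait G g p" by blast
  then show ?thesis using nucleus_portrait_unique by blast
qed

section \<open>Deterministic multi-tape Turing machines\<close>

datatype move = Left | Right | Stay

text \<open>The blank is None. A tape (l, r) carries the reversal of l to the left of the head; the head
  scans the first cell of r; all other cells are blank.\<close>

type_synonym 'a tape = "'a option list \<times> 'a option list"

fun scan :: "'a tape \<Rightarrow> 'a option" where
  "scan (l, []) = None"
| "scan (l, a # r) = a"

fun move_head :: "move \<Rightarrow> 'a tape \<Rightarrow> 'a tape" where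
  "move_head Stay (l, r) = (l, r)"
| "move_head Left ([], r) = ([], None # r)"
| "move_head Left (a # l, r) = (l, a # r)"
| "move_head Right (l, r) = (scan (l, r) # l, tl r)"

fun act :: "'a option \<times> move \<Rightarrow> 'a tape \<Rightarrow> 'a tape" where
  "act (a, m) (l, r) = move_head m (l, a # tl r)"

text \<open>The states are 0, ..., num_states M; state 0 is initial, num_states M is the halting state.\<close>

record 'a machine =
  num_tapes :: nat
  alphabet :: "'a set"
  num_states :: nat
  trans :: "nat \<Rightarrow> 'a option list \<Rightarrow> nat \<times> ('a option \<times> move) list"

definition cells :: "'a set \<Rightarrow> 'a option set" where
  "cells \<Gamma> = insert None (Some ` \<Gamma>)"

definition turing_machine :: "'a machine \<Rightarrow> bool" where
  "turing_machine M \<longleftrightarrow>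
     num_tapes M \<ge> 1 \<and> finite (alphabet M) \<and>
     (\<forall>q as. q < num_states M \<longrightarrow> length as = num_tapes M \<longrightarrow> set as \<subseteq> cells (alphabet M) \<longrightarrow>
       fst (trans M q as) \<le> num_states M \<and>
       length (snd (trans M q as)) = num_tapes M \<and>
       fst ` set (snd (trans M q as)) \<subseteq> cells (alphabet M))"

type_synonym 'a config = "nat \<times> 'a tape list"

fun step :: "'a machine \<Rightarrow> 'a config \<Rightarrow> 'a config" where
  "step M (q, ts) =
     (if q \<ge> num_states M then (q, ts)
      else (fst (trans M q (map scan ts)), map2 act (snd (trans M q (map scan ts))) ts))"

definition initial :: "'a machine \<Rightarrow> 'a list \<Rightarrow> 'a config" where
  "initial M inp = (0, ([], map Some inp) # replicate (num_tapes M - 1) ([], []))"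

text \<open>The output is the maximal blank-free word starting at the head of the last tape.\<close>

definition tape_output :: "'a config \<Rightarrow> 'a list" where
  "tape_output c = map the (takeWhile (\<lambda>a. a \<noteq> None) (snd (last (snd c))))"

definition computes_within :: "'a machine \<Rightarrow> 'a list \<Rightarrow> 'a list \<Rightarrow> nat \<Rightarrow> bool" where
  "computes_within M inp out n \<longleftrightarrow>
     set inp \<subseteq> alphabet M \<and>
     (\<exists>k\<le>n. fst ((step M ^^ k) (initial M inp)) = num_states M \<and>
            tape_output ((step M ^^ k) (initial M inp)) = out)"

section \<open>Inputs and outputs\<close>

text \<open>The finitely many labels (nucleus elements, permutations) and generators are themselves tape
  symbols; Aux provides working symbols.  A machine uses only finitely many symbols.\<close>

datatype 'x symbol =
    Leaf_Label "'x tree_map"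
  | Perm_Label "'x \<Rightarrow> 'x"
  | Generator "'x tree_map"
  | Yes
  | No
  | Aux nat

text \<open>Prefix traversal, visiting the children in the order of the enumeration xs of the
  alphabet.\<close>

primrec encode :: "'x list \<Rightarrow> 'x portrait \<Rightarrow> 'x symbol list" where
  "encode xs (Leaf g) = [Leaf_Label g]"
| "encode xs (Node s c) = Perm_Label s # concat (map (\<lambda>x. encode xs (c x)) xs)"

end

(* Let K be the subgroup over which G branches.  Whether an element g with all its first-level sections
   g_x in G lies in G depends only on its root permutation and on the cosets K g_x: with coset
   representatives r_x, the element (g_x r_x^-1)_x lies in K^d, hence in K, and g is its product with
   one of finitely many elements built from the permutation and the r_x.  So membership is decided by
   a finite tree automaton running bottom-up over the portrait.  A word for g is obtained from words
   for the g_x by Schreier rewriting: each g_x r_x^-1 is a product of increments in K, finitely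
   many in all, and each increment injected at x has a fixed word in S.  Hence lengths grow by a
   constant factor per level, and so does the running time of a Turing machine that reads the
   prefix code of the portrait from right to left and keeps a stack of words. *)

theory Submission
  imports Defs
begin

section \<open>Three-tape programs with structured control states\<close>

text \<open>A section outside G excludes g at once, by self-similarity, so the coset criterion is
  only ever applied to sections that already have words. These words grow with the depth and cannot
  be looked up in a table. They are rewritten letter by letter by a transducer whose state is a
  coset representative, and this makes the expansion factor a constant \<open>L\<close>. The
  representatives, the words for increments and the membership test at a node are obtained by
  choice, with no procedure for finding them. They enter through finitely many arguments only,
  because K has finite index and S and the set of permutations are finite; hence they can be written
  into the transition table of a machine that depends on G and S. While a node is processed,
  operands are popped and a new word is produced; a middle tape buffers the output, since the
  remaining operands still occupy the top of the stack. Running times are tracked for sets of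
  configurations, because the number of blank cells left behind on the tapes is irrelevant.\<close>

type_synonym ('q, 'a) program =
  "'q \<Rightarrow> 'a option \<Rightarrow> 'a option \<Rightarrow> 'a option \<Rightarrow>
     'q option \<times> ('a option \<times> move) \<times> ('a option \<times> move) \<times> ('a option \<times> move)"

type_synonym ('q, 'a) program_config = "'q option \<times> 'a tape \<times> 'a tape \<times> 'a tape"

fun program_step :: "('q, 'a) program \<Rightarrow> ('q, 'a) program_config \<Rightarrow> ('q, 'a) program_config" where
  "program_step \<delta> (None, t0, t1, t2) = (None, t0, t1, t2)"
| "program_step \<delta> (Some q, t0, t1, t2) =
     (case \<delta> q (scan t0) (scan t1) (scan t2) of
        (q', x, y, z) \<Rightarrow> (q', act x t0, act y t1, act z t2))"

text \<open>A machine starts in state 0, so \<open>q0\<close> is set apart and the numbering of the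
  other states is shifted by one.\<close>

lemma finite_enumeration_from:
  assumes "finite Q" and "q0 \<in> Q"
  obtains f :: "'q \<Rightarrow> nat" where "inj_on f Q" and "f q0 = 0" and "\<And>q. q \<in> Q \<Longrightarrow> f q < card Q"
proof -
  obtain h :: "'q \<Rightarrow> nat" where h: "bij_betw h (Q - {q0}) {0..<card (Q - {q0})}"
    using ex_bij_betw_finite_nat[of "Q - {q0}"] assms(1) by auto
  define f where "f q = (if q = q0 then 0 else Suc (h q))" for q
  have "inj_on f Q"
    using h by (auto simp: inj_on_def f_def bij_betw_def)
  moreover have "f q0 = 0" by (simp add: f_def)
  moreover have "f q < card Q" if "q \<in> Q" for q
  proof (cases "q = q0")
    case True
    then show ?thesis using assms by (auto simp: f_def card_gt_0_iff)
  next
    case False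
    then have "h q < card (Q - {q0})"
      using h that by (auto simp: bij_betw_def)
    moreover have "0 < card Q" using assms by (auto simp: card_gt_0_iff)
    ultimately show ?thesis using False assms by (simp add: f_def card_Diff_singleton)
  qed
  ultimately show thesis by (rule that)
qed

text \<open>Control states carry lists, so their type may be infinite; finiteness is asked of a set
  of states closed under transitions. Halting, which is \<open>None\<close> in a program, becomes
  the number \<open>card Q\<close>.\<close>

lemma realize_program:
  fixes \<delta> :: "('q, 'a) program"
  assumes "finite Q" and "q0 \<in> Q" and "finite \<Gamma>"
    and closed: "\<And>q a b c q' x y z. q \<in> Q \<Longrightarrow> \<delta> q a b c = (Some q', x, y, z) \<Longrightarrow> q' \<in> Q"
    and symbols: "\<And>q a b c q' x y z. q \<in> Q \<Longrightarrow> {a, b, c} \<subseteq> cells \<Gamma> \<Longrightarrow>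
      \<delta> q a b c = (q', x, y, z) \<Longrightarrow> {fst x, fst y, fst z} \<subseteq> cells \<Gamma>"
  obtains M where "turing_machine M"
    and "\<And>inp n t0 t1 t2. set inp \<subseteq> \<Gamma> \<Longrightarrow>
      (program_step \<delta> ^^ n) (Some q0, ([], map Some inp), ([], []), ([], [])) = (None, t0, t1, t2) \<Longrightarrow>
      computes_within M inp (tape_output (0, [t0, t1, t2])) n"
proof -
  obtain f where inj: "inj_on f Q" and f0: "f q0 = 0" and f_less: "\<And>q. q \<in> Q \<Longrightarrow> f q < card Q"
    using finite_enumeration_from[OF assms(1,2)] by blast
  define code where "code q = (case q of None \<Rightarrow> card Q | Some s \<Rightarrow> f s)" for q
  define \<tau> where "\<tau> q as =
    (case \<delta> (inv_into Q f q) (as ! 0) (as ! 1) (as ! 2) of (q', x, y, z) \<Rightarrow> (code q', [x, y, z]))" for q as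
  define M where "M = \<lparr>num_tapes = 3, alphabet = \<Gamma>, num_states = card Q, trans = \<tau>\<rparr>"
  have surj: "f ` Q = {..<card Q}"
    using inj f_less by (intro card_subset_eq) (auto simp: card_image)
  have code_le: "code q \<le> card Q" if "set_option q \<subseteq> Q" for q
    using that f_less by (cases q) (auto simp: code_def less_imp_le)
  have "turing_machine M"
    unfolding turing_machine_def
  proof (intro conjI allI impI)
    fix q and as :: "'a option list"
    assume q: "q < num_states M" and len: "length as = num_tapes M"
      and as: "set as \<subseteq> cells (alphabet M)"
    obtain q' x y z where d: "\<delta> (inv_into Q f q) (as ! 0) (as ! 1) (as ! 2) = (q', x, y, z)"
      by (metis prod_cases4)
    have Q: "inv_into Q f q \<in> Q"
      using q surj by (intro inv_into_into) (simp add: M_def)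
    have "{as ! 0, as ! 1, as ! 2} \<subseteq> cells \<Gamma>"
      using len as by (auto simp: M_def)
    from symbols[OF Q this d] closed[OF Q] d
    show "fst (trans M q as) \<le> num_states M"
      and "length (snd (trans M q as)) = num_tapes M"
      and "fst ` set (snd (trans M q as)) \<subseteq> cells (alphabet M)"
      using code_le[of q'] by (cases q'; auto simp: M_def \<tau>_def)+
  qed (use assms(3) in \<open>auto simp: M_def\<close>)
  moreover have "computes_within M inp (tape_output (0, [t0, t1, t2])) n"
    if inp: "set inp \<subseteq> \<Gamma>"
      and halt: "(program_step \<delta> ^^ n) (Some q0, ([], map Some inp), ([], []), ([], [])) = (None, t0, t1, t2)"
    for inp n t0 t1 t2
  proof -
    define c0 :: "('q, 'a) program_config"
      where "c0 = (Some q0, ([], map Some inp), ([], []), ([], []))"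
    define enc :: "('q, 'a) program_config \<Rightarrow> 'a config"
      where "enc = (\<lambda>(q, u0, u1, u2). (code q, [u0, u1, u2]))"
    have init: "enc c0 = initial M inp"
      by (simp add: enc_def c0_def initial_def code_def f0 M_def numeral_eq_Suc)
    have step: "step M (enc c) = enc (program_step \<delta> c) \<and> set_option (fst (program_step \<delta> c)) \<subseteq> Q"
      if "set_option (fst c) \<subseteq> Q" for c
    proof -
      obtain q u0 u1 u2 where c: "c = (q, u0, u1, u2)" by (metis prod_cases4)
      show ?thesis
      proof (cases q)
        case None
        then show ?thesis by (simp add: c enc_def code_def M_def)
      next
        case (Some s)
        then have s: "s \<in> Q" using that c by simp
        obtain q' x y z where d: "\<delta> s (scan u0) (scan u1) (scan u2) = (q', x, y, z)"
          by (metis prod_cases4)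
        have "set_option q' \<subseteq> Q" using closed[OF s] d by (cases q') auto
        moreover have "inv_into Q f (f s) = s" using inj s by simp
        ultimately show ?thesis
          using f_less[OF s] d by (simp add: c Some enc_def code_def M_def \<tau>_def)
      qed
    qed
    have "(step M ^^ n) (enc c0) = enc ((program_step \<delta> ^^ n) c0) \<and>
        set_option (fst ((program_step \<delta> ^^ n) c0)) \<subseteq> Q" for n
    proof (induction n)
      case 0
      then show ?case using assms(2) by (simp add: c0_def)
    next
      case (Suc n)
      then show ?case using step by simp
    qed
    then have "(step M ^^ n) (initial M inp) = (card Q, [t0, t1, t2])"
      using halt unfolding init by (simp add: c0_def enc_def code_def)
    then show ?thesis
      using inp by (auto simp: computes_within_def M_def tape_output_def intro!: exI[of _ n])
  qed
  ultimately show thesis by (rule that)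
qed

section \<open>Time-bounded reachability\<close>

text \<open>Allowing fewer steps than the bound lets branches of different cost share one
  estimate.\<close>

definition leads :: "('q, 'a) program \<Rightarrow> nat \<Rightarrow> ('q, 'a) program_config set \<Rightarrow>
    ('q, 'a) program_config set \<Rightarrow> bool" where
  "leads \<delta> n A B \<longleftrightarrow> (\<forall>c\<in>A. \<exists>m\<le>n. (program_step \<delta> ^^ m) c \<in> B)"

lemma leads_refl: "leads \<delta> 0 A A"
  by (simp add: leads_def)

lemma leads_step: "(\<And>c. c \<in> A \<Longrightarrow> program_step \<delta> c \<in> B) \<Longrightarrow> leads \<delta> 1 A B"
  by (auto simp: leads_def intro: exI[of _ 1])

lemma leads_trans:
  assumes "leads \<delta> n A B" and "leads \<delta> m B C"
  shows "leads \<delta> (n + m) A C"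
  unfolding leads_def
proof
  fix c assume "c \<in> A"
  then obtain i where i: "i \<le> n" "(program_step \<delta> ^^ i) c \<in> B"
    using assms(1) by (auto simp: leads_def)
  then obtain j where j: "j \<le> m" "(program_step \<delta> ^^ j) ((program_step \<delta> ^^ i) c) \<in> C"
    using assms(2) by (auto simp: leads_def)
  then show "\<exists>k\<le>n + m. (program_step \<delta> ^^ k) c \<in> C"
    using i(1) by (intro exI[of _ "j + i"]) (simp add: funpow_add)
qed

lemma leads_mono: "leads \<delta> n A B \<Longrightarrow> n \<le> m \<Longrightarrow> leads \<delta> m A B"
  unfolding leads_def using le_trans by blast

text \<open>\<open>tape_output\<close> looks at the last tape only, so the state 0 is a
  dummy.\<close>

definition halted :: "'a list \<Rightarrow> ('q, 'a) program_config set" where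
  "halted out = {(None, t0, t1, t2) | t0 t1 t2. tape_output (0, [t0, t1, t2]) = out}"

lemma leads_halted: "leads \<delta> n A (halted out) \<Longrightarrow> leads \<delta> (n + m) A (halted out)"
  by (rule leads_mono) auto

section \<open>Evaluating a portrait with a stack of words\<close>

text \<open>\<open>Pop \<sigma> rs r\<close> remembers the permutation of the node, the
  representatives reached by the children already popped, and the transducer state for the current
  child. \<open>Emit w q\<close> writes \<open>w\<close> and resumes at \<open>q\<close>.
  \<open>Lift\<close> and \<open>Move\<close> carry the finished word from the middle tape to the
  stack.\<close>

datatype 'x control =
    Seek
  | Read
  | Pop "'x \<Rightarrow> 'x" "'x tree_map list" "'x tree_map"
  | Emit "'x tree_map list" "'x control"
  | Lift
  | Move
  | Reject

section \<open>Tape layouts\<close>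

text \<open>The head is on the symbol to be read next. To the left of the input a blank appears, and
  scanning it means that the whole portrait has been read.\<close>

fun tape_before :: "'a list \<Rightarrow> 'a option list \<Rightarrow> 'a tape" where
  "tape_before [] r = ([], None # r)"
| "tape_before (a # l) r = (map Some l, Some a # r)"

lemma move_Left_tape_before [simp]: "move_head Left (map Some l, r) = tape_before l r"
  by (cases l) auto

lemma act_stay_tape_before [simp]: "act (scan (tape_before l r), Stay) (tape_before l r) = tape_before l r"
  by (cases l) auto

abbreviation gens :: "'x tree_map list \<Rightarrow> 'x symbol option list" where
  "gens w \<equiv> map (\<lambda>s. Some (Generator s)) w"

text \<open>A blank in front of every word doubles as the separator between two words.\<close>

definition stack :: "'x tree_map list list \<Rightarrow> 'x symbol option list" where
  "stack ws = concat (map (\<lambda>w. None # gens w) ws) @ [None]"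

lemma stack_Nil [simp]: "stack [] = [None]"
  and stack_Cons [simp]: "stack (w # ws) = None # gens w @ stack ws"
  by (simp_all add: stack_def)

text \<open>The last operand of a node is ended by the blank that already belongs to the stack
  underneath, which therefore has to survive.\<close>

lemma stack_blank_first: "\<exists>r. stack ws = None # r"
  by (cases ws) auto

text \<open>Configurations: the input tape still has to be read leftwards (next symbol first), the middle
  tape collects a word, and the last tape carries a stack growing to the left.\<close>

definition at_state :: "'x control \<Rightarrow> 'x symbol list \<Rightarrow> 'x tree_map list \<Rightarrow> 'x symbol option list \<Rightarrow>
    ('x control, 'x symbol) program_config set" where
  "at_state q todo out st =
     {(Some q, tape_before todo r, (gens (rev out), bs), (l, st)) | r bs l.
        set bs \<subseteq> {None} \<and> set l \<subseteq> {None}}"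

text \<open>The middle head is on the last letter not yet moved; copying backwards onto a stack that
  grows to the left restores the order of the word. The blank before \<open>st\<close> is the next
  cell to be written and finally serves as the separator.\<close>

definition at_move :: "'x symbol list \<Rightarrow> 'x tree_map list \<Rightarrow> 'x symbol option list \<Rightarrow>
    ('x control, 'x symbol) program_config set" where
  "at_move todo out st =
     {(Some Move, tape_before todo r, tape_before (map Generator (rev out)) bs, (l, None # st)) | r bs l.
        set bs \<subseteq> {None} \<and> set l \<subseteq> {None}}"

lemma at_stateE:
  assumes "c \<in> at_state q todo out st"
  obtains r bs l where "c = (Some q, tape_before todo r, (gens (rev out), bs), (l, st))"
    and "set bs \<subseteq> {None}" and "set l \<subseteq> {None}"
  using assms unfolding at_state_def by blast

lemma at_stateI:
  "c = (Some q, tape_before todo r, (gens (rev out), bs), (l, st)) \<Longrightarrow> set bs \<subseteq> {None} \<Longrightarrow>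
    set l \<subseteq> {None} \<Longrightarrow> c \<in> at_state q todo out st"
  unfolding at_state_def by blast

lemma at_moveE:
  assumes "c \<in> at_move todo out st"
  obtains r bs l where
    "c = (Some Move, tape_before todo r, tape_before (map Generator (rev out)) bs, (l, None # st))"
    and "set bs \<subseteq> {None}" and "set l \<subseteq> {None}"
  using assms unfolding at_move_def by blast

lemma at_moveI:
  "c = (Some Move, tape_before todo r, tape_before (map Generator (rev out)) bs, (l, None # st)) \<Longrightarrow>
    set bs \<subseteq> {None} \<Longrightarrow> set l \<subseteq> {None} \<Longrightarrow> c \<in> at_move todo out st"
  unfolding at_move_def by blast

lemma move_Left_blanks:
  assumes "set l \<subseteq> {None}"
  obtains l' where "move_head Left (l, r) = (l', None # r)" and "set l' \<subseteq> {None}"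
  using assms by (cases l) auto

lemma set_tl_blank: "set bs \<subseteq> {None} \<Longrightarrow> set (tl bs) \<subseteq> {None}"
  by (cases bs) auto

lemma scan_blanks: "set bs \<subseteq> {None} \<Longrightarrow> scan (l, bs) = None"
  by (cases bs) auto

lemma scan_tl: "st \<noteq> [] \<Longrightarrow> scan (l, st) # tl st = st"
  by (cases st) auto

text \<open>Only closure and size of the tables are assumed, which is what the machine and its
  running time depend on; their group-theoretic meaning enters with
  \<open>branching\<close>.\<close>

locale portrait_machine =
  fixes xs :: "'x::finite list"
    and S R :: "'x tree_map set"
    and start :: "'x tree_map"
    and nxt :: "'x tree_map \<Rightarrow> 'x tree_map \<Rightarrow> 'x tree_map"
    and emission :: "'x \<Rightarrow> 'x tree_map \<Rightarrow> 'x tree_map \<Rightarrow> 'x tree_map list"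
    and final :: "('x \<Rightarrow> 'x) \<Rightarrow> 'x tree_map list \<Rightarrow> 'x tree_map list option"
    and L :: nat
  assumes letters: "set xs = UNIV"
    and finite_S: "finite S" and finite_R: "finite R"
    and start: "start \<in> R"
    and nxt: "r \<in> R \<Longrightarrow> s \<in> S \<Longrightarrow> nxt r s \<in> R"
    and emission: "r \<in> R \<Longrightarrow> s \<in> S \<Longrightarrow> set (emission x r s) \<subseteq> S \<and> length (emission x r s) \<le> L"
    and final: "set rs \<subseteq> R \<Longrightarrow> length rs = length xs \<Longrightarrow> final \<sigma> rs = Some f \<Longrightarrow>
      set f \<subseteq> S \<and> length f \<le> L"
begin

primrec transduce :: "'x \<Rightarrow> 'x tree_map \<Rightarrow> 'x tree_map list \<Rightarrow> 'x tree_map list" where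
  "transduce x r [] = []"
| "transduce x r (s # w) = emission x r s @ transduce x (nxt r s) w"

definition run :: "'x tree_map list \<Rightarrow> 'x tree_map" where
  "run w = foldl nxt start w"

definition combine :: "('x \<Rightarrow> 'x) \<Rightarrow> ('x \<Rightarrow> 'x tree_map list option) \<Rightarrow> 'x tree_map list option" where
  "combine \<sigma> h =
     (if \<exists>x. h x = None then None
      else map_option (\<lambda>f. concat (map (\<lambda>x. transduce x start (the (h x))) xs) @ f)
        (final \<sigma> (map (\<lambda>x. run (the (h x))) xs)))"

primrec eval_portrait :: "'x portrait \<Rightarrow> 'x tree_map list option" where
  "eval_portrait (Leaf g) = Some [g]"
| "eval_portrait (Node \<sigma> c) = combine \<sigma> (\<lambda>x. eval_portrait (c x))"

text \<open>The tests for membership in \<open>S\<close> keep the reachable states in a finite set.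
  The input head stays on a label until the resulting word has been moved. On success
  \<open>Yes\<close> overwrites the separator in front of the only word on the stack, so that
  verdict and word are read off together.\<close>

fun delta :: "('x control, 'x symbol) program" where
  "delta Seek a b c =
     (case a of None \<Rightarrow> (Some Read, (None, Left), (None, Stay), (None, Stay))
      | Some _ \<Rightarrow> (Some Seek, (a, Right), (None, Stay), (None, Stay)))"
| "delta Read a b c =
     (case a of None \<Rightarrow> (None, (a, Stay), (b, Stay), (Some Yes, Stay))
      | Some (Leaf_Label g) \<Rightarrow>
          (if g \<in> S then Some (Emit [g] Lift) else None, (a, Stay), (b, Stay), (None, Stay))
      | Some (Perm_Label \<sigma>) \<Rightarrow> (Some (Pop \<sigma> [] start), (a, Stay), (b, Stay), (None, Right))
      | _ \<Rightarrow> (None, (a, Stay), (b, Stay), (c, Stay)))"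
| "delta (Pop \<sigma> rs r) a b c =
     (case c of None \<Rightarrow>
          (if Suc (length rs) < length xs
           then (Some (Pop \<sigma> (rs @ [r]) start), (a, Stay), (b, Stay), (None, Right))
           else case final \<sigma> (rs @ [r]) of
               None \<Rightarrow> (Some Reject, (a, Stay), (b, Stay), (None, Left))
             | Some f \<Rightarrow> (Some (Emit f Lift), (a, Stay), (b, Stay), (None, Stay)))
      | Some (Generator s) \<Rightarrow>
          (if s \<in> S then Some (Emit (emission (xs ! length rs) r s) (Pop \<sigma> rs (nxt r s))) else None,
           (a, Stay), (b, Stay), (None, Right))
      | _ \<Rightarrow> (None, (a, Stay), (b, Stay), (c, Stay)))"
| "delta (Emit [] q) a b c = (Some q, (a, Stay), (b, Stay), (c, Stay))"
| "delta (Emit (s # w) q) a b c =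
     (Some (Emit w q), (a, Stay), (Some (Generator s), Right), (c, Stay))"
| "delta Lift a b c = (Some Move, (a, Stay), (None, Left), (None, Left))"
| "delta Move a b c =
     (case b of None \<Rightarrow> (Some Read, (a, Left), (None, Stay), (c, Stay))
      | Some _ \<Rightarrow> (Some Move, (a, Stay), (None, Left), (b, Left)))"
| "delta Reject a b c = (None, (a, Stay), (b, Stay), (Some No, Stay))"

abbreviation leads_to where "leads_to \<equiv> leads delta"

section \<open>Finiteness of the control and of the tape alphabet\<close>

definition tape_symbols :: "'x symbol set" where
  "tape_symbols = Leaf_Label ` S \<union> Perm_Label ` UNIV \<union> Generator ` S \<union> {Yes, No}"

definition base_states :: "'x control set" where
  "base_states = {Seek, Read, Lift, Move, Reject} \<union>
     {Pop \<sigma> rs r | \<sigma> rs r. set rs \<subseteq> R \<and> length rs < length xs \<and> r \<in> R}"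

text \<open>The bound is \<open>Suc L\<close> because the single letter of a leaf is emitted too,
  even if \<open>L\<close> is 0. Continuations are basic states, so \<open>Emit\<close> is never
  nested.\<close>

definition states :: "'x control set" where
  "states = base_states \<union>
     {Emit w q | w q. set w \<subseteq> S \<and> length w \<le> Suc L \<and> q \<in> base_states}"

lemma finite_states: "finite states"
proof -
  have "{Pop \<sigma> rs r | \<sigma> rs r. set rs \<subseteq> R \<and> length rs < length xs \<and> r \<in> R}
      \<subseteq> (\<lambda>(\<sigma>, rs, r). Pop \<sigma> rs r) ` (UNIV \<times> {rs. set rs \<subseteq> R \<and> length rs \<le> length xs} \<times> R)"
    by (auto simp: image_iff)
  then have base: "finite base_states"
    unfolding base_states_def using finite_R finite_lists_length_le[OF finite_R, of "length xs"]
    by (auto dest: finite_subset)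
  have "{Emit w q | w q. set w \<subseteq> S \<and> length w \<le> Suc L \<and> q \<in> base_states}
      \<subseteq> (\<lambda>(w, q). Emit w q) ` ({w. set w \<subseteq> S \<and> length w \<le> Suc L} \<times> base_states)"
    by (auto simp: image_iff)
  then show ?thesis
    unfolding states_def using base finite_lists_length_le[OF finite_S, of "Suc L"]
    by (auto dest: finite_subset)
qed

lemma xs_nonempty: "xs \<noteq> []"
  using letters by auto

lemma base_states_closed:
  assumes "q \<in> base_states" and "delta q a b c = (Some q', x, y, z)"
  shows "q' \<in> states"
proof (cases q)
  case (Pop \<sigma> rs r)
  then have q: "set rs \<subseteq> R" "length rs < length xs" "r \<in> R"
    using assms(1) by (auto simp: base_states_def)
  show ?thesis
  proof (cases c)
    case None
    show ?thesis
    proof (cases "Suc (length rs) < length xs")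
      case True
      then show ?thesis using assms(2) q start by (auto simp: Pop None states_def base_states_def)
    next
      case False
      then have "length (rs @ [r]) = length xs" using q by simp
      then have "set f \<subseteq> S \<and> length f \<le> L" if "final \<sigma> (rs @ [r]) = Some f" for f
        using that q by (intro final) auto
      then show ?thesis
        using assms(2) False by (auto simp: Pop None states_def base_states_def le_SucI split: option.splits)
    qed
  next
    case (Some u)
    have "emission x r s \<in> {w. set w \<subseteq> S \<and> length w \<le> Suc L}" if "s \<in> S" for x s
      using emission[OF q(3) that, of x] by auto
    then show ?thesis
      using assms(2) q by (auto simp: Pop Some states_def base_states_def nxt split: symbol.splits if_splits)
  qed
qed (use assms start xs_nonempty in \<open>auto simp: states_def base_states_def
       split: option.splits symbol.splits if_splits\<close>)

lemma delta_closed: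
  assumes "q \<in> states" and "delta q a b c = (Some q', x, y, z)"
  shows "q' \<in> states"
proof (cases "q \<in> base_states")
  case True
  then show ?thesis using base_states_closed assms(2) by blast
next
  case False
  then obtain w p where w: "q = Emit w p" "set w \<subseteq> S" "length w \<le> Suc L" "p \<in> base_states"
    using assms(1) by (auto simp: states_def)
  then show ?thesis using assms(2) by (cases w) (auto simp: states_def)
qed

lemma delta_symbols:
  assumes "q \<in> states" and "{a, b, c} \<subseteq> cells tape_symbols" and "delta q a b c = (q', x, y, z)"
  shows "{fst x, fst y, fst z} \<subseteq> cells tape_symbols"
proof -
  define C where "C = cells tape_symbols"
  have C: "None \<in> C" "Some Yes \<in> C" "Some No \<in> C" "\<And>s. s \<in> S \<Longrightarrow> Some (Generator s) \<in> C"
    by (auto simp: C_def cells_def tape_symbols_def)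
  have abc: "a \<in> C" "b \<in> C" "c \<in> C" using assms(2) by (auto simp: C_def)
  have "{fst x, fst y, fst z} \<subseteq> C"
  proof (cases q)
    case (Emit w p)
    then have "set w \<subseteq> S" using assms(1) by (auto simp: states_def base_states_def)
    then show ?thesis using assms(3) abc C by (cases w) (auto simp: Emit)
  qed (use assms(3) abc C in \<open>auto split: option.splits symbol.splits if_splits\<close>)
  then show ?thesis by (simp add: C_def)
qed

section \<open>Step counts of the elementary phases\<close>

text \<open>The stack needs a cell under its head: writing back a scanned blank on an empty list
  would create a cell and change the representation.\<close>

lemma emit_step:
  assumes "st \<noteq> []"
  shows "leads_to 1 (at_state (Emit [] q) T out st) (at_state q T out st)"
    and "leads_to 1 (at_state (Emit (s # w) q) T out st) (at_state (Emit w q) T (out @ [s]) st)"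
proof -
  show "leads_to 1 (at_state (Emit [] q) T out st) (at_state q T out st)"
  proof (rule leads_step)
    fix c assume "c \<in> at_state (Emit [] q) T out st"
    then obtain r bs l where c: "c = (Some (Emit [] q), tape_before T r, (gens (rev out), bs), (l, st))"
      and b: "set bs \<subseteq> {None}" "set l \<subseteq> {None}" by (rule at_stateE)
    show "program_step delta c \<in> at_state q T out st"
      by (rule at_stateI[of _ _ _ r _ "None # tl bs" l])
        (use b set_tl_blank[OF b(1)] in \<open>simp_all add: c scan_blanks scan_tl[OF assms]\<close>)
  qed
  show "leads_to 1 (at_state (Emit (s # w) q) T out st) (at_state (Emit w q) T (out @ [s]) st)"
  proof (rule leads_step)
    fix c assume "c \<in> at_state (Emit (s # w) q) T out st"
    then obtain r bs l where
      c: "c = (Some (Emit (s # w) q), tape_before T r, (gens (rev out), bs), (l, st))"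
      and b: "set bs \<subseteq> {None}" "set l \<subseteq> {None}" by (rule at_stateE)
    show "program_step delta c \<in> at_state (Emit w q) T (out @ [s]) st"
      by (rule at_stateI[of _ _ _ r _ "tl bs" l])
        (use b set_tl_blank[OF b(1)] in \<open>simp_all add: c scan_tl[OF assms]\<close>)
  qed
qed

lemma emit:
  assumes "st \<noteq> []"
  shows "leads_to (Suc (length w)) (at_state (Emit w q) T out st) (at_state q T (out @ w) st)"
proof (induction w arbitrary: out)
  case Nil
  then show ?case using emit_step(1)[OF assms] by simp
next
  case (Cons s w)
  from leads_trans[OF emit_step(2)[OF assms] Cons.IH] show ?case by simp
qed

lemma lift: "leads_to 1 (at_state Lift T out (None # st)) (at_move T out (None # st))"
proof (rule leads_step)
  fix c assume "c \<in> at_state Lift T out (None # st)"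
  then obtain r bs l where c: "c = (Some Lift, tape_before T r, (gens (rev out), bs), (l, None # st))"
    and b: "set bs \<subseteq> {None}" "set l \<subseteq> {None}" by (rule at_stateE)
  obtain l' where l': "move_head Left (l, None # st) = (l', None # None # st)" "set l' \<subseteq> {None}"
    using move_Left_blanks[OF b(2)] by blast
  have out: "gens (rev out) = map Some (map Generator (rev out))" by simp
  show "program_step delta c \<in> at_move T out (None # st)"
    by (rule at_moveI[of _ _ r _ "None # tl bs" l'])
      (use l' set_tl_blank[OF b(1)] in \<open>simp_all add: c out del: map_map\<close>)
qed

lemma move_step:
  "leads_to 1 (at_move T (out @ [s]) st) (at_move T out (Some (Generator s) # st))"
proof (rule leads_step)
  fix c assume "c \<in> at_move T (out @ [s]) st"
  then obtain r bs l where c: "c = (Some Move, tape_before T r,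
      tape_before (map Generator (rev (out @ [s]))) bs, (l, None # st))"
    and b: "set bs \<subseteq> {None}" "set l \<subseteq> {None}" by (rule at_moveE)
  obtain l' where l': "move_head Left (l, Some (Generator s) # st) = (l', None # Some (Generator s) # st)"
    "set l' \<subseteq> {None}"
    using move_Left_blanks[OF b(2)] by blast
  show "program_step delta c \<in> at_move T out (Some (Generator s) # st)"
    by (rule at_moveI[of _ _ r _ "None # bs" l'])
      (use l' b in \<open>simp_all add: c del: map_map\<close>)
qed

lemma move_end:
  "leads_to 1 (at_move (a # T) [] st) (at_state Read T [] (None # st))"
proof (rule leads_step)
  fix c assume "c \<in> at_move (a # T) [] st"
  then obtain r bs l where c: "c = (Some Move, tape_before (a # T) r,
      tape_before (map Generator (rev [])) bs, (l, None # st))"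
    and b: "set bs \<subseteq> {None}" "set l \<subseteq> {None}" by (rule at_moveE)
  show "program_step delta c \<in> at_state Read T [] (None # st)"
    by (rule at_stateI[of _ _ _ "Some a # r" _ "None # bs" l])
      (use b in \<open>simp_all add: c\<close>)
qed

lemma move:
  "leads_to (Suc (length out)) (at_move (a # T) out st) (at_state Read T [] (None # gens out @ st))"
proof (induction out arbitrary: st rule: rev_induct)
  case Nil
  then show ?case using move_end by simp
next
  case (snoc s out)
  from leads_trans[OF move_step snoc.IH] show ?case by simp
qed

lemma lift_stack:
  "leads_to (length out + 2) (at_state Lift (a # T) out (stack ws)) (at_state Read T [] (stack (out # ws)))"
proof -
  obtain st where st: "stack ws = None # st" using stack_blank_first by blast
  from leads_trans[OF lift move] show ?thesis by (simp add: st)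
qed

lemma pop_letter:
  assumes "s \<in> S"
  shows "leads_to 1 (at_state (Pop \<sigma> rs r) T out (Some (Generator s) # st))
    (at_state (Emit (emission (xs ! length rs) r s) (Pop \<sigma> rs (nxt r s))) T out st)"
proof (rule leads_step)
  fix c assume "c \<in> at_state (Pop \<sigma> rs r) T out (Some (Generator s) # st)"
  then obtain t bs l where c: "c = (Some (Pop \<sigma> rs r), tape_before T t, (gens (rev out), bs),
      (l, Some (Generator s) # st))"
    and b: "set bs \<subseteq> {None}" "set l \<subseteq> {None}" by (rule at_stateE)
  show "program_step delta c \<in>
      at_state (Emit (emission (xs ! length rs) r s) (Pop \<sigma> rs (nxt r s))) T out st"
    by (rule at_stateI[of _ _ _ t _ "None # tl bs" "None # l"])
      (use b set_tl_blank[OF b(1)] assms in \<open>simp_all add: c scan_blanks\<close>)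
qed

lemma pop_next:
  assumes "Suc (length rs) < length xs"
  shows "leads_to 1 (at_state (Pop \<sigma> rs r) T out (None # st)) (at_state (Pop \<sigma> (rs @ [r]) start) T out st)"
proof (rule leads_step)
  fix c assume "c \<in> at_state (Pop \<sigma> rs r) T out (None # st)"
  then obtain t bs l where c: "c = (Some (Pop \<sigma> rs r), tape_before T t, (gens (rev out), bs), (l, None # st))"
    and b: "set bs \<subseteq> {None}" "set l \<subseteq> {None}" by (rule at_stateE)
  show "program_step delta c \<in> at_state (Pop \<sigma> (rs @ [r]) start) T out st"
    by (rule at_stateI[of _ _ _ t _ "None # tl bs" "None # l"])
      (use b set_tl_blank[OF b(1)] assms in \<open>simp_all add: c scan_blanks\<close>)
qed

text \<open>Unlike in \<open>pop_next\<close>, the separator is kept, since it begins the rest of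
  the stack. On failure the step to the left leaves two blanks in a row: \<open>No\<close> will
  overwrite the first, and the second ends the output.\<close>

lemma pop_last:
  assumes "Suc (length rs) = length xs"
  shows "final \<sigma> (rs @ [r]) = Some f \<Longrightarrow>
      leads_to 1 (at_state (Pop \<sigma> rs r) T out (None # st)) (at_state (Emit f Lift) T out (None # st))"
    and "final \<sigma> (rs @ [r]) = None \<Longrightarrow>
      leads_to 1 (at_state (Pop \<sigma> rs r) T out (None # st)) (at_state Reject T out (None # None # st))"
proof -
  assume f: "final \<sigma> (rs @ [r]) = Some f"
  show "leads_to 1 (at_state (Pop \<sigma> rs r) T out (None # st)) (at_state (Emit f Lift) T out (None # st))"
  proof (rule leads_step)
    fix c assume "c \<in> at_state (Pop \<sigma> rs r) T out (None # st)"
    then obtain t bs l where c: "c = (Some (Pop \<sigma> rs r), tape_before T t, (gens (rev out), bs), (l, None # st))"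
      and b: "set bs \<subseteq> {None}" "set l \<subseteq> {None}" by (rule at_stateE)
    show "program_step delta c \<in> at_state (Emit f Lift) T out (None # st)"
      by (rule at_stateI[of _ _ _ t _ "None # tl bs" l])
        (use b set_tl_blank[OF b(1)] assms f in \<open>simp_all add: c scan_blanks\<close>)
  qed
next
  assume f: "final \<sigma> (rs @ [r]) = None"
  show "leads_to 1 (at_state (Pop \<sigma> rs r) T out (None # st)) (at_state Reject T out (None # None # st))"
  proof (rule leads_step)
    fix c assume "c \<in> at_state (Pop \<sigma> rs r) T out (None # st)"
    then obtain t bs l where c: "c = (Some (Pop \<sigma> rs r), tape_before T t, (gens (rev out), bs), (l, None # st))"
      and b: "set bs \<subseteq> {None}" "set l \<subseteq> {None}" by (rule at_stateE)
    obtain l' where l': "move_head Left (l, None # st) = (l', None # None # st)" "set l' \<subseteq> {None}"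
      using move_Left_blanks[OF b(2)] by blast
    show "program_step delta c \<in> at_state Reject T out (None # None # st)"
      by (rule at_stateI[of _ _ _ t _ "None # tl bs" l'])
        (use l' b(1) set_tl_blank[OF b(1)] assms f in \<open>simp_all add: c scan_blanks\<close>)
  qed
qed

lemma reject: "leads_to 1 (at_state Reject T out (None # None # st)) (halted [No])"
proof (rule leads_step)
  fix c assume "c \<in> at_state Reject T out (None # None # st)"
  then obtain t bs l where c: "c = (Some Reject, tape_before T t, (gens (rev out), bs), (l, None # None # st))"
    by (rule at_stateE)
  show "program_step delta c \<in> halted [No]"
    by (simp add: c halted_def tape_output_def)
qed

lemma read_leaf:
  assumes "g \<in> S"
  shows "leads_to 1 (at_state Read (Leaf_Label g # T) [] (stack ws))
    (at_state (Emit [g] Lift) (Leaf_Label g # T) [] (stack ws))"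
proof (rule leads_step)
  fix c assume "c \<in> at_state Read (Leaf_Label g # T) [] (stack ws)"
  then obtain t bs l where c: "c = (Some Read, tape_before (Leaf_Label g # T) t, (gens (rev []), bs), (l, stack ws))"
    and b: "set bs \<subseteq> {None}" "set l \<subseteq> {None}" by (rule at_stateE)
  obtain st where st: "stack ws = None # st" using stack_blank_first by blast
  show "program_step delta c \<in> at_state (Emit [g] Lift) (Leaf_Label g # T) [] (stack ws)"
    by (rule at_stateI[of _ _ _ t _ "None # tl bs" l])
      (use b set_tl_blank[OF b(1)] assms in \<open>simp_all add: c scan_blanks st\<close>)
qed

lemma read_node:
  "leads_to 1 (at_state Read (Perm_Label \<sigma> # T) [] (stack (w # ws)))
    (at_state (Pop \<sigma> [] start) (Perm_Label \<sigma> # T) [] (gens w @ stack ws))"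
proof (rule leads_step)
  fix c assume "c \<in> at_state Read (Perm_Label \<sigma> # T) [] (stack (w # ws))"
  then obtain t bs l where c: "c = (Some Read, tape_before (Perm_Label \<sigma> # T) t, (gens (rev []), bs),
      (l, stack (w # ws)))"
    and b: "set bs \<subseteq> {None}" "set l \<subseteq> {None}" by (rule at_stateE)
  show "program_step delta c \<in> at_state (Pop \<sigma> [] start) (Perm_Label \<sigma> # T) [] (gens w @ stack ws)"
    by (rule at_stateI[of _ _ _ t _ "None # tl bs" "None # l"])
      (use b set_tl_blank[OF b(1)] in \<open>simp_all add: c scan_blanks\<close>)
qed

lemma takeWhile_gens: "map the (takeWhile (\<lambda>a. a \<noteq> None) (gens w @ [None])) = map Generator w"
  by (induction w) auto

lemma read_end: "leads_to 1 (at_state Read [] [] (stack [w])) (halted (Yes # map Generator w))"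
proof (rule leads_step)
  fix c assume "c \<in> at_state Read [] [] (stack [w])"
  then obtain t bs l where c: "c = (Some Read, tape_before [] t, (gens (rev []), bs), (l, stack [w]))"
    by (rule at_stateE)
  show "program_step delta c \<in> halted (Yes # map Generator w)"
    using takeWhile_gens[of w] by (simp add: c halted_def tape_output_def)
qed

lemma seek:
  "leads_to (Suc (length inp)) {(Some Seek, (map Some done, map Some inp), ([], bs), ([], [None]))}
    (at_state Read (rev inp @ done) [] (stack []))"
  if "set bs \<subseteq> {None}"
  using that
proof (induction inp arbitrary: "done" bs)
  case Nil
  have "leads_to 1 {(Some Seek, (map Some done, []), ([], bs), ([], [None]))}
      (at_state Read done [] (stack []))"
    by (intro leads_step at_stateI[of _ _ _ "[None]" _ "None # tl bs" "[]"])
      (use set_tl_blank[OF Nil] in simp_all)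
  then show ?case by simp
next
  case (Cons a inp)
  have "leads_to 1 {(Some Seek, (map Some done, map Some (a # inp)), ([], bs), ([], [None]))}
      {(Some Seek, (map Some (a # done), map Some inp), ([], None # tl bs), ([], [None]))}"
    by (intro leads_step) simp
  from leads_trans[OF this Cons.IH] show ?case
    using set_tl_blank[OF Cons.prems] by simp
qed

text \<open>The first step is treated separately because it turns the empty last tape into the
  single blank that represents the empty stack.\<close>

lemma initial_seek:
  "inp \<noteq> [] \<Longrightarrow> leads_to (Suc (length inp)) {(Some Seek, ([], map Some inp), ([], []), ([], []))}
    (at_state Read (rev inp) [] (stack []))"
proof -
  assume "inp \<noteq> []"
  then obtain a inp' where inp: "inp = a # inp'" by (cases inp) auto
  have "leads_to 1 {(Some Seek, ([], map Some inp), ([], []), ([], []))}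
      {(Some Seek, (map Some [a], map Some inp'), ([], [None]), ([], [None]))}"
    by (intro leads_step) (simp add: inp)
  from leads_trans[OF this seek] show ?thesis by (simp add: inp)
qed

text \<open>Each letter costs one step to pop and at most \<open>L + 1\<close> steps to emit its
  output and return.\<close>

lemma pop_word:
  assumes "set w \<subseteq> S" and "r \<in> R" and "st \<noteq> []"
  shows "leads_to (length w * (L + 2)) (at_state (Pop \<sigma> rs r) T out (gens w @ st))
    (at_state (Pop \<sigma> rs (foldl nxt r w)) T (out @ transduce (xs ! length rs) r w) st)"
  using assms(1,2)
proof (induction w arbitrary: r out)
  case Nil
  then show ?case by (simp add: leads_refl)
next
  case (Cons s w)
  have e: "length (emission (xs ! length rs) r s) \<le> L" using emission Cons.prems by simp
  have "leads_to (1 + Suc (length (emission (xs ! length rs) r s)) + length w * (L + 2))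
      (at_state (Pop \<sigma> rs r) T out (Some (Generator s) # gens w @ st))
      (at_state (Pop \<sigma> rs (foldl nxt (nxt r s) w)) T
        ((out @ emission (xs ! length rs) r s) @ transduce (xs ! length rs) (nxt r s) w) st)"
    using Cons.prems assms(3)
    by (intro leads_trans[OF leads_trans[OF pop_letter emit] Cons.IH]) (auto intro: nxt)
  then show ?case using e by (auto elim: leads_mono)
qed

lemma foldl_nxt: "set w \<subseteq> S \<Longrightarrow> r \<in> R \<Longrightarrow> foldl nxt r w \<in> R"
  by (induction w arbitrary: r) (auto intro: nxt)

lemma run_in: "set w \<subseteq> S \<Longrightarrow> run w \<in> R"
  unfolding run_def using foldl_nxt start by blast

text \<open>The children \<open>zs\<close> are done, and only their representatives
  \<open>rs\<close> are kept in the control. Each child costs one more step at its closing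
  separator; the last summand 1 pays for writing \<open>No\<close>.\<close>

lemma pop_words:
  assumes "\<And>x. set (f x) \<subseteq> S" and "\<And>x. length (f x) \<le> n"
    and "xs = zs @ y # ys" and "length rs = length zs"
  shows "leads_to (Suc (length ys) * (n * (L + 2) + 1) + 1)
    (at_state (Pop \<sigma> rs start) T out (gens (f y) @ stack (map f ys @ ws)))
    (case final \<sigma> (rs @ map (\<lambda>x. run (f x)) (y # ys)) of
       None \<Rightarrow> halted [No]
     | Some g \<Rightarrow> at_state (Emit g Lift) T
         (out @ concat (map (\<lambda>x. transduce x start (f x)) (y # ys))) (stack ws))"
  using assms(3,4)
proof (induction ys arbitrary: y zs rs out)
  case Nil
  obtain st where st: "stack ws = None # st" using stack_blank_first by blast
  have y: "xs ! length rs = y" and l: "Suc (length rs) = length xs" using Nil by simp_all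
  have "leads_to (length (f y) * (L + 2)) (at_state (Pop \<sigma> rs start) T out (gens (f y) @ stack ws))
      (at_state (Pop \<sigma> rs (run (f y))) T (out @ transduce y start (f y)) (stack ws))"
    using pop_word[OF assms(1) start, of "stack ws" y \<sigma> rs T out] by (simp add: y run_def st)
  moreover have "length (f y) * (L + 2) \<le> n * (L + 2)" using assms(2) by (rule mult_right_mono) simp
  ultimately have w: "leads_to (n * (L + 2)) (at_state (Pop \<sigma> rs start) T out (gens (f y) @ stack ws))
      (at_state (Pop \<sigma> rs (run (f y))) T (out @ transduce y start (f y)) (stack ws))"
    by (rule leads_mono)
  show ?case
  proof (cases "final \<sigma> (rs @ [run (f y)])")
    case None
    from leads_trans[OF leads_trans[OF w[unfolded st] pop_last(2)[OF l None]] reject]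
    show ?thesis by (simp add: None st)
  next
    case (Some g)
    from leads_trans[OF w[unfolded st] pop_last(1)[OF l Some]]
    show ?thesis by (auto simp: Some st elim: leads_mono)
  qed
next
  case (Cons y' ys)
  have y: "xs ! length rs = y" and l: "Suc (length rs) < length xs" using Cons.prems by simp_all
  have "leads_to (length (f y) * (L + 2))
      (at_state (Pop \<sigma> rs start) T out (gens (f y) @ stack (map f (y' # ys) @ ws)))
      (at_state (Pop \<sigma> rs (run (f y))) T (out @ transduce y start (f y)) (stack (map f (y' # ys) @ ws)))"
    using pop_word[OF assms(1) start, of "stack (map f (y' # ys) @ ws)" y \<sigma> rs T out]
    by (simp add: y run_def)
  moreover have "length (f y) * (L + 2) \<le> n * (L + 2)" using assms(2) by (rule mult_right_mono) simp
  ultimately have "leads_to (n * (L + 2))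
      (at_state (Pop \<sigma> rs start) T out (gens (f y) @ stack (map f (y' # ys) @ ws)))
      (at_state (Pop \<sigma> rs (run (f y))) T (out @ transduce y start (f y))
        (None # gens (f y') @ stack (map f ys @ ws)))"
    by (auto elim: leads_mono)
  from leads_trans[OF leads_trans[OF this pop_next[OF l]]
      Cons.IH[of "zs @ [y]" y' "rs @ [run (f y)]" "out @ transduce y start (f y)"]]
  have "leads_to (n * (L + 2) + 1 + (Suc (length ys) * (n * (L + 2) + 1) + 1))
      (at_state (Pop \<sigma> rs start) T out (gens (f y) @ stack (map f (y' # ys) @ ws)))
      (case final \<sigma> (rs @ map (\<lambda>x. run (f x)) (y # y' # ys)) of
         None \<Rightarrow> halted [No]
       | Some g \<Rightarrow> at_state (Emit g Lift) T
           (out @ concat (map (\<lambda>x. transduce x start (f x)) (y # y' # ys))) (stack ws))"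
    using Cons.prems by (simp cong: option.case_cong)
  then show ?case by (rule leads_mono) simp
qed

section \<open>Length bounds\<close>

lemma length_transduce:
  "set w \<subseteq> S \<Longrightarrow> r \<in> R \<Longrightarrow> set (transduce x r w) \<subseteq> S \<and> length (transduce x r w) \<le> L * length w"
proof (induction w arbitrary: r)
  case (Cons s w)
  then show ?case using Cons.IH[OF _ nxt, of r s] emission[of r s x] by auto
qed simp

lemma combine_bound:
  assumes "combine \<sigma> h = Some w" and "\<And>x v. h x = Some v \<Longrightarrow> set v \<subseteq> S \<and> length v \<le> n"
  shows "set w \<subseteq> S \<and> length w \<le> length xs * (L * n) + L"
proof -
  from assms(1) obtain f where h: "\<And>x. h x \<noteq> None"
    and f: "final \<sigma> (map (\<lambda>x. run (the (h x))) xs) = Some f"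
    and w: "w = concat (map (\<lambda>x. transduce x start (the (h x))) xs) @ f"
    by (auto simp: combine_def split: if_splits)
  have the: "set (the (h x)) \<subseteq> S" "length (the (h x)) \<le> n" for x
    using assms(2)[of x "the (h x)"] h[of x] by auto
  have t: "set (transduce x start (the (h x))) \<subseteq> S" "length (transduce x start (the (h x))) \<le> L * n" for x
    using length_transduce[OF the(1) start, of x x] the(2)[of x]
    by (auto intro: order_trans[OF _ mult_left_mono])
  have "sum_list (map (\<lambda>x. length (transduce x start (the (h x)))) xs) \<le> sum_list (map (\<lambda>x. L * n) xs)"
    using t by (intro sum_list_mono) simp
  moreover have "set f \<subseteq> S \<and> length f \<le> L"
    using f the(1) by (intro final) (auto intro: run_in)
  ultimately show ?thesis
    using t(1) by (auto simp: w length_concat comp_def sum_list_triv)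
qed

lemma set_encode_child: "set (encode xs (Node \<sigma> c)) \<subseteq> A \<Longrightarrow> set (encode xs (c x)) \<subseteq> A"
  using letters by auto

text \<open>Word lengths obey the recursion n \<mapsto> d L n + L, with d the size of the alphabet,
  and for n \<ge> 1 the right side is at most (d L + L) n. The summand 1 keeps all powers
  positive.\<close>

definition growth :: nat where
  "growth = length xs * L + L + 1"

lemma eval_portrait_bound:
  "set (encode xs p) \<subseteq> tape_symbols \<Longrightarrow> depth p \<le> t \<Longrightarrow> eval_portrait p = Some w \<Longrightarrow>
    set w \<subseteq> S \<and> length w \<le> growth ^ t"
proof (induction p arbitrary: t w)
  case (Leaf g)
  then show ?case by (auto simp: tape_symbols_def growth_def)
next
  case (Node \<sigma> c)
  then obtain t' where t: "t = Suc t'" by (cases t) auto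
  have "set w \<subseteq> S \<and> length w \<le> length xs * (L * growth ^ t') + L"
  proof (rule combine_bound)
    show "combine \<sigma> (\<lambda>x. eval_portrait (c x)) = Some w" using Node.prems(3) by simp
    show "set v \<subseteq> S \<and> length v \<le> growth ^ t'" if "eval_portrait (c x) = Some v" for x v
      using Node.IH[of "c x" t' v] set_encode_child[OF Node.prems(1), of x] Node.prems(2) that
      by (simp add: t)
  qed
  moreover have "length xs * (L * growth ^ t') + L \<le> growth ^ t"
  proof -
    have "1 \<le> growth ^ t'" by (rule one_le_power) (simp add: growth_def)
    then have "L * 1 \<le> L * growth ^ t'" by (rule mult_left_mono) simp
    moreover have "length xs * (L * growth ^ t') + L * growth ^ t' \<le> growth ^ t"
      by (simp add: t growth_def algebra_simps)
    ultimately show ?thesis by linarith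
  qed
  ultimately show ?case by linarith
qed

text \<open>A bound m \<ge> 1 for every child gives 1 + d m \<le> (d + 1) m for the node.\<close>

lemma length_encode: "depth p \<le> t \<Longrightarrow> length (encode xs p) \<le> (length xs + 1) ^ t"
proof (induction p arbitrary: t)
  case (Node \<sigma> c)
  then obtain t' where t: "t = Suc t'" by (cases t) auto
  have "sum_list (map (\<lambda>x. length (encode xs (c x))) xs) \<le> sum_list (map (\<lambda>x. (length xs + 1) ^ t') xs)"
    using Node by (intro sum_list_mono Node.IH) (auto simp: t)
  then have "1 + sum_list (map (\<lambda>x. length (encode xs (c x))) xs)
      \<le> (length xs + 1) ^ t' + sum_list (map (\<lambda>x. (length xs + 1) ^ t') xs)"
    by (intro add_mono) simp_all
  then show ?case
    by (simp add: t length_concat comp_def sum_list_triv)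
qed simp

section \<open>Running time of the evaluation\<close>

text \<open>The free \<open>T\<close> and \<open>ws\<close> allow use for a subtree inside a larger
  portrait. Rejection is global, since a section outside G rules out every element that has it as a
  section.\<close>

definition outcome where
  "outcome p T ws = (case eval_portrait p of None \<Rightarrow> halted [No] | Some w \<Rightarrow> at_state Read T [] (stack (w # ws)))"

text \<open>Reading from the right meets the last child first, so its word lies deepest and the word
  of the first child ends on top, as \<open>pop_words\<close> expects. Hence the tail
  \<open>ys\<close> is processed before \<open>y\<close>.\<close>

lemma eval_children:
  assumes "\<And>x T ws. leads_to n (at_state Read (rev (encode xs (c x)) @ T) [] (stack ws)) (outcome (c x) T ws)"
  shows "leads_to (length ys * n)
    (at_state Read (rev (concat (map (\<lambda>x. encode xs (c x)) ys)) @ T) [] (stack ws))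
    (if \<exists>x\<in>set ys. eval_portrait (c x) = None then halted [No]
     else at_state Read T [] (stack (map (\<lambda>x. the (eval_portrait (c x))) ys @ ws)))"
proof (induction ys arbitrary: T)
  case Nil
  then show ?case by (simp add: leads_refl)
next
  case (Cons y ys)
  note IH = Cons.IH[of "rev (encode xs (c y)) @ T"]
  show ?case
  proof (cases "\<exists>x\<in>set ys. eval_portrait (c x) = None")
    case True
    with leads_halted[of _ "length ys * n" _ "[No]" n] IH show ?thesis by (simp add: add.commute)
  next
    case False
    from leads_trans[OF IH[unfolded if_not_P[OF False]] assms[of y]] False
    show ?thesis by (cases "eval_portrait (c y)") (auto simp: outcome_def add.commute)
  qed
qed

text \<open>Steps at a node outside its subtrees, per unit of the bound on the words of its
  children: popping accounts for \<open>length xs * (L + 3)\<close>, the rest covers emitting the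
  final word, moving the result and constant overhead.\<close>

definition cost :: nat where
  "cost = length xs * (L + 3) + growth + L + 6"

text \<open>Chosen so that one geometric sequence dominates the recursion T(t) = d T(t - 1) +
  \<open>cost * growth ^ t\<close>; it exceeds \<open>growth\<close>, so the inhomogeneous term is
  absorbed.\<close>

definition time_growth :: nat where
  "time_growth = length xs + cost * growth"

lemma eval_leads:
  "set (encode xs p) \<subseteq> tape_symbols \<Longrightarrow> depth p \<le> t \<Longrightarrow>
    leads_to (6 * time_growth ^ t) (at_state Read (rev (encode xs p) @ T) [] (stack ws)) (outcome p T ws)"
proof (induction p arbitrary: t T ws)
  case (Leaf g)
  then have "g \<in> S" by (auto simp: tape_symbols_def)
  obtain st where st: "stack ws = None # st" using stack_blank_first by blast
  \<comment> \<open>One step to read, two to emit a letter and return, three to lift and move it: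
    this is the factor 6.\<close>
  from leads_trans[OF leads_trans[OF read_leaf[OF \<open>g \<in> S\<close>] emit] lift_stack, of ws T] st
  have "leads_to 6 (at_state Read (rev (encode xs (Leaf g)) @ T) [] (stack ws)) (outcome (Leaf g) T ws)"
    by (simp add: st outcome_def numeral_eq_Suc)
  moreover have "1 \<le> time_growth ^ t"
    using xs_nonempty by (intro one_le_power) (auto simp: time_growth_def Suc_le_eq)
  ultimately show ?case by (auto elim: leads_mono)
next
  case (Node \<sigma> c)
  then obtain t' where t: "t = Suc t'" by (cases t) auto
  let ?n = "growth ^ t'"
  let ?f = "\<lambda>x. the (eval_portrait (c x))"
  have ch: "set (encode xs (c x)) \<subseteq> tape_symbols" "depth (c x) \<le> t'" for x
    using Node.prems(2) set_encode_child[OF Node.prems(1)] by (simp_all add: t)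
  have children: "leads_to (length xs * (6 * time_growth ^ t'))
    (at_state Read (rev (concat (map (\<lambda>x. encode xs (c x)) xs)) @ Perm_Label \<sigma> # T) [] (stack ws))
    (if \<exists>x\<in>set xs. eval_portrait (c x) = None then halted [No]
     else at_state Read (Perm_Label \<sigma> # T) [] (stack (map ?f xs @ ws)))"
    by (rule eval_children, rule Node.IH) (use ch in auto)
  have start: "rev (encode xs (Node \<sigma> c)) @ T
      = rev (concat (map (\<lambda>x. encode xs (c x)) xs)) @ Perm_Label \<sigma> # T" by simp
  have total: "length xs * (6 * time_growth ^ t') + cost * growth ^ t \<le> 6 * time_growth ^ t"
  proof -
    have "growth \<le> time_growth"
      by (simp add: time_growth_def cost_def trans_le_add2)
    then have "growth ^ t' \<le> time_growth ^ t'" by (rule power_mono) simp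
    then have "cost * growth * growth ^ t' \<le> cost * growth * time_growth ^ t'" by (rule mult_left_mono) simp
    moreover have "6 * time_growth ^ t =
        length xs * (6 * time_growth ^ t') + 6 * (cost * growth * time_growth ^ t')"
      unfolding t power_Suc by (subst time_growth_def) (simp add: algebra_simps)
    moreover have "cost * growth ^ t = cost * growth * growth ^ t'" by (simp add: t)
    ultimately show ?thesis by linarith
  qed
  show ?case
  proof (cases "\<exists>x\<in>set xs. eval_portrait (c x) = None")
    case True
    with children have "leads_to (length xs * (6 * time_growth ^ t'))
        (at_state Read (rev (encode xs (Node \<sigma> c)) @ T) [] (stack ws)) (halted [No])"
      by (simp add: start)
    moreover from True have "\<exists>x. eval_portrait (c x) = None" by blast
    then have "eval_portrait (Node \<sigma> c) = None"
      unfolding eval_portrait.simps combine_def by (rule if_P)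
    then have "outcome (Node \<sigma> c) T ws = halted [No]"
      by (simp add: outcome_def del: eval_portrait.simps)
    ultimately show ?thesis using total by (auto elim: leads_mono)
  next
    case False
    then have ev: "eval_portrait (c x) = Some (?f x)" for x using letters by auto
    have f: "set (?f x) \<subseteq> S" "length (?f x) \<le> ?n" for x
      using eval_portrait_bound[OF ch ev] by auto
    obtain y ys where xs: "xs = y # ys" using xs_nonempty by (cases xs) auto
    have combined: "eval_portrait (Node \<sigma> c) = map_option
        (\<lambda>g. concat (map (\<lambda>x. transduce x start (?f x)) xs) @ g) (final \<sigma> (map (\<lambda>x. run (?f x)) xs))"
      unfolding eval_portrait.simps combine_def by (rule if_not_P) (metis ev option.distinct(1))
    have "leads_to (Suc (length ys) * (?n * (L + 2) + 1) + 1)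
      (at_state (Pop \<sigma> [] start) (Perm_Label \<sigma> # T) [] (gens (?f y) @ stack (map ?f ys @ ws)))
      (case final \<sigma> ([] @ map (\<lambda>x. run (?f x)) (y # ys)) of
         None \<Rightarrow> halted [No]
       | Some g \<Rightarrow> at_state (Emit g Lift) (Perm_Label \<sigma> # T)
           ([] @ concat (map (\<lambda>x. transduce x start (?f x)) (y # ys))) (stack ws))"
      using f xs by (intro pop_words[where zs = "[]"]) auto
    then have pop: "leads_to (length xs * (?n * (L + 2) + 1) + 1)
      (at_state (Pop \<sigma> [] start) (Perm_Label \<sigma> # T) [] (gens (?f y) @ stack (map ?f ys @ ws)))
      (case final \<sigma> (map (\<lambda>x. run (?f x)) xs) of
         None \<Rightarrow> halted [No]
       | Some g \<Rightarrow> at_state (Emit g Lift) (Perm_Label \<sigma> # T)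
           (concat (map (\<lambda>x. transduce x start (?f x)) xs)) (stack ws))"
      by (simp only: xs append_Nil length_Cons)
    have "at_state Read (Perm_Label \<sigma> # T) [] (stack (map ?f xs @ ws))
        = at_state Read (Perm_Label \<sigma> # T) [] (stack (?f y # map ?f ys @ ws))"
      by (simp only: xs list.map append_Cons)
    with children[unfolded if_not_P[OF False]]
    have "leads_to (length xs * (6 * time_growth ^ t'))
        (at_state Read (rev (encode xs (Node \<sigma> c)) @ T) [] (stack ws))
        (at_state Read (Perm_Label \<sigma> # T) [] (stack (?f y # map ?f ys @ ws)))"
      unfolding start by metis
    from leads_trans[OF leads_trans[OF this read_node] pop]
    have until_final: "leads_to (length xs * (6 * time_growth ^ t') + 1 + (length xs * (?n * (L + 2) + 1) + 1))
      (at_state Read (rev (encode xs (Node \<sigma> c)) @ T) [] (stack ws))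
      (case final \<sigma> (map (\<lambda>x. run (?f x)) xs) of
         None \<Rightarrow> halted [No]
       | Some g \<Rightarrow> at_state (Emit g Lift) (Perm_Label \<sigma> # T)
           (concat (map (\<lambda>x. transduce x start (?f x)) xs)) (stack ws))" .
    have n1: "1 \<le> ?n" by (rule one_le_power) (simp add: growth_def)
    have cost: "1 + (length xs * (?n * (L + 2) + 1) + 1) + (Suc L + (growth * ?n + 2)) \<le> cost * growth ^ t"
    proof -
      have mono: "length xs \<le> length xs * ?n" "L \<le> L * ?n" using n1 by simp_all
      have "1 + (length xs * (?n * (L + 2) + 1) + 1) + (Suc L + (growth * ?n + 2))
          = length xs * (?n * (L + 2)) + length xs + L + growth * ?n + 5"
        by (simp add: algebra_simps)
      also have "\<dots> \<le> length xs * (?n * (L + 2)) + length xs * ?n + L * ?n + growth * ?n + 6 * ?n"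
        using mono n1 by linarith
      also have "\<dots> = cost * ?n"
        by (simp add: cost_def algebra_simps)
      also have "\<dots> \<le> cost * growth ^ t"
        by (intro mult_left_mono power_increasing) (auto simp: t growth_def)
      finally show ?thesis .
    qed
    show ?thesis
    proof (cases "final \<sigma> (map (\<lambda>x. run (?f x)) xs)")
      case None
      then have "outcome (Node \<sigma> c) T ws = halted [No]" by (simp add: outcome_def combined del: eval_portrait.simps)
      with leads_mono[OF until_final[unfolded None option.case]] show ?thesis
        using total cost by simp
    next
      case (Some g)
      define w where "w = concat (map (\<lambda>x. transduce x start (?f x)) xs) @ g"
      have w: "eval_portrait (Node \<sigma> c) = Some w" by (simp add: combined Some w_def del: eval_portrait.simps)
      have w_len: "length w \<le> growth * ?n"
        using eval_portrait_bound[OF Node.prems w] by (simp add: t)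
      have g_len: "length g \<le> L"
        using final[OF _ _ Some] run_in[OF f(1)] by auto
      obtain st where st: "stack ws = None # st" using stack_blank_first by blast
      have "leads_to (Suc (length g) + (length w + 2))
          (at_state (Emit g Lift) (Perm_Label \<sigma> # T) (concat (map (\<lambda>x. transduce x start (?f x)) xs)) (stack ws))
          (outcome (Node \<sigma> c) T ws)"
        unfolding outcome_def w option.case
        using st unfolding w_def by (intro leads_trans[OF emit lift_stack]) simp
      from leads_trans[OF until_final[unfolded Some option.case] this]
      have "leads_to (length xs * (6 * time_growth ^ t') + 1 + (length xs * (?n * (L + 2) + 1) + 1) +
          (Suc (length g) + (length w + 2)))
        (at_state Read (rev (encode xs (Node \<sigma> c)) @ T) [] (stack ws)) (outcome (Node \<sigma> c) T ws)" .
      then show ?thesis by (rule leads_mono) (use w_len g_len total cost in linarith)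
    qed
  qed
qed

theorem machine_exists:
  obtains M where "turing_machine M"
    and "\<And>p. set (encode xs p) \<subseteq> tape_symbols \<Longrightarrow>
      computes_within M (encode xs p)
        (case eval_portrait p of None \<Rightarrow> [No] | Some w \<Rightarrow> Yes # map Generator w)
        (9 * (time_growth + length xs + 1) ^ depth p)"
proof -
  have "finite tape_symbols" using finite_S by (simp add: tape_symbols_def)
  moreover have "Seek \<in> states" by (simp add: states_def base_states_def)
  ultimately obtain M where M: "turing_machine M"
    and run: "\<And>inp n t0 t1 t2. set inp \<subseteq> tape_symbols \<Longrightarrow>
      (program_step delta ^^ n) (Some Seek, ([], map Some inp), ([], []), ([], [])) = (None, t0, t1, t2) \<Longrightarrow>
      computes_within M inp (tape_output (0, [t0, t1, t2])) n"
    using realize_program[OF finite_states, of Seek tape_symbols delta] delta_closed delta_symbols by metis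
  have "computes_within M (encode xs p)
      (case eval_portrait p of None \<Rightarrow> [No] | Some w \<Rightarrow> Yes # map Generator w)
      (9 * (time_growth + length xs + 1) ^ depth p)"
    if p: "set (encode xs p) \<subseteq> tape_symbols" for p
  proof -
    let ?out = "case eval_portrait p of None \<Rightarrow> [No] | Some w \<Rightarrow> Yes # map Generator w"
    let ?D = "(time_growth + length xs + 1) ^ depth p"
    have ne: "encode xs p \<noteq> []" by (cases p) auto
    from leads_trans[OF initial_seek[OF ne]] eval_leads[OF p order_refl, of "[]" "[]"]
    have l: "leads_to (Suc (length (encode xs p)) + 6 * time_growth ^ depth p)
        {(Some Seek, ([], map Some (encode xs p)), ([], []), ([], []))} (outcome p [] [])" by simp
    have total: "leads_to (Suc (length (encode xs p)) + 6 * time_growth ^ depth p + 1)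
        {(Some Seek, ([], map Some (encode xs p)), ([], []), ([], []))} (halted ?out)"
    proof (cases "eval_portrait p")
      case None
      then show ?thesis using leads_halted[of _ _ _ "[No]" 1] l by (simp add: outcome_def)
    next
      case (Some w)
      then show ?thesis using leads_trans[OF _ read_end[of w]] l by (simp add: outcome_def)
    qed
    have "time_growth ^ depth p \<le> ?D" "(length xs + 1) ^ depth p \<le> ?D"
      by (rule power_mono; simp)+
    moreover have "1 \<le> ?D" by (rule one_le_power) simp
    \<comment> \<open>Seeking the right end costs at most \<open>?D + 1\<close>, the evaluation
      \<open>6 * ?D\<close> and the last step 1; as \<open>?D\<close> is at least 1, the sum is at
      most \<open>9 * ?D\<close>.\<close>
    ultimately have "Suc (length (encode xs p)) + 6 * time_growth ^ depth p + 1 \<le> 9 * ?D"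
      using length_encode[of p "depth p"] by linarith
    with total have "leads_to (9 * ?D)
        {(Some Seek, ([], map Some (encode xs p)), ([], []), ([], []))} (halted ?out)"
      by (rule leads_mono)
    then obtain k t0 t1 t2 where k: "k \<le> 9 * ?D"
      "(program_step delta ^^ k) (Some Seek, ([], map Some (encode xs p)), ([], []), ([], [])) = (None, t0, t1, t2)"
      "tape_output (0, [t0, t1, t2]) = ?out"
      by (auto simp: leads_def halted_def)
    from run[OF p k(2)] k(1,3) show ?thesis
      unfolding computes_within_def using le_trans by (auto, blast)
  qed
  with M show thesis by (rule that)
qed

end

section \<open>Coset rewriting in a regular branch group\<close>

text \<open>Assembles a map from its root action and sections without asking that the result be an
  automorphism, so the test at a node makes sense for every label and every list of
  representatives.\<close>

definition graft :: "('x \<Rightarrow> 'x) \<Rightarrow> ('x \<Rightarrow> 'x tree_map) \<Rightarrow> 'x tree_map" where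
  "graft \<sigma> h w = (case w of [] \<Rightarrow> [] | x # u \<Rightarrow> \<sigma> x # h x u)"

lemma graft_simps [simp]: "graft \<sigma> h [] = []" "graft \<sigma> h (x # u) = \<sigma> x # h x u"
  by (simp_all add: graft_def)

lemma mult_AutT: "g \<otimes>\<^bsub>AutT\<^esub> h = h \<circ> g"
  by (simp add: AutT_def)

text \<open>The left factor acts first and fixes the first level, so the sections multiply vertex by
  vertex without being permuted.\<close>

lemma graft_mult: "graft id k \<otimes>\<^bsub>AutT\<^esub> graft \<sigma> h = graft \<sigma> (\<lambda>x. k x \<otimes>\<^bsub>AutT\<^esub> h x)"
proof
  show "(graft id k \<otimes>\<^bsub>AutT\<^esub> graft \<sigma> h) w = graft \<sigma> (\<lambda>x. k x \<otimes>\<^bsub>AutT\<^esub> h x) w" for w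
    by (cases w) (simp_all add: mult_AutT)
qed

lemma graft_one: "graft id (\<lambda>_. \<one>\<^bsub>AutT\<^esub>) = \<one>\<^bsub>AutT\<^esub>"
proof
  show "graft id (\<lambda>_. \<one>\<^bsub>AutT\<^esub>) w = \<one>\<^bsub>AutT\<^esub> w" for w :: "'x list"
    by (cases w) (simp_all add: AutT_def)
qed

lemma tree_aut_graft:
  assumes "g \<in> tree_auts"
  shows "g = graft (root_perm g) (\<lambda>x. section_at g [x])"
proof
  fix w
  show "g w = graft (root_perm g) (\<lambda>x. section_at g [x]) w"
  proof (cases w)
    case Nil
    then show ?thesis using assms by (simp add: tree_auts_def)
  next
    case (Cons x u)
    have "g [x] = [root_perm g x]"
      using tree_aut_length[OF assms, of "[x]"] by (cases "g [x]") (auto simp: root_perm_def)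
    then show ?thesis using section_spec[OF assms, of "[x]" u] by (simp add: Cons)
  qed
qed

lemmas AutT_monoid = group.is_monoid[OF group_AutT]

lemmas AutT_assoc = monoid.m_assoc[OF AutT_monoid]

lemmas AutT_simps = monoid.m_closed[OF AutT_monoid] monoid.one_closed[OF AutT_monoid]
  monoid.l_one[OF AutT_monoid] monoid.r_one[OF AutT_monoid]
  group.inv_closed[OF group_AutT] group.l_inv[OF group_AutT] group.r_inv[OF group_AutT]
  group.inv_inv[OF group_AutT] monoid.inv_one[OF AutT_monoid]

lemma AutT_inv_cancel:
  "g \<in> carrier AutT \<Longrightarrow> h \<in> carrier AutT \<Longrightarrow> inv\<^bsub>AutT\<^esub> g \<otimes>\<^bsub>AutT\<^esub> (g \<otimes>\<^bsub>AutT\<^esub> h) = h"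
  by (simp add: AutT_assoc[symmetric] AutT_simps)

locale branching =
  fixes G K S :: "('x::finite) tree_map set" and xs :: "'x list"
  assumes distinct: "distinct xs" and letters: "set xs = UNIV"
    and G: "subgroup G AutT" and K: "subgroup K AutT" and K_sub: "K \<subseteq> G"
    and branch: "(\<Pi>\<^sub>E x\<in>UNIV. K) \<subseteq> Psi ` (level1_stabilizer G \<inter> K)"
    and index: "finite_index AutT G K"
    and section_in_G: "g \<in> G \<Longrightarrow> section_at g [x] \<in> G"
    and finite_S: "finite S" and S_inv: "\<forall>s\<in>S. inv\<^bsub>AutT\<^esub> s \<in> S" and S_sub: "S \<subseteq> G"
    and generated: "generate AutT S = G" and nucleus: "nucleus G \<subseteq> S"
begin

lemmas carrier_G = subgroup.mem_carrier[OF G]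

section \<open>Words over the generators\<close>

lemma word_value_Nil: "word_value [] = \<one>\<^bsub>AutT\<^esub>"
  and word_value_Cons: "word_value (s # w) = s \<otimes>\<^bsub>AutT\<^esub> word_value w"
  by (simp_all add: word_value_def)

lemma word_value_in_G: "set w \<subseteq> S \<Longrightarrow> word_value w \<in> G"
proof (induction w)
  case Nil
  then show ?case using subgroup.one_closed[OF G] by (simp add: word_value_Nil AutT_simps)
next
  case (Cons s w)
  then show ?case using subgroup.m_closed[OF G] S_sub by (auto simp: word_value_Cons)
qed

lemma word_value_append:
  assumes "set u \<subseteq> S" and "set v \<subseteq> S"
  shows "word_value (u @ v) = word_value u \<otimes>\<^bsub>AutT\<^esub> word_value v"
  using assms
proof (induction u)
  case Nil
  then show ?case using carrier_G[OF word_value_in_G] by (simp add: word_value_Nil AutT_simps)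
next
  case (Cons s u)
  then have "s \<in> carrier AutT" using S_sub carrier_G by auto
  then show ?case
    using Cons carrier_G[OF word_value_in_G] by (simp add: word_value_Cons AutT_assoc AutT_simps)
qed

lemma word_exists:
  assumes "g \<in> G"
  shows "\<exists>w. set w \<subseteq> S \<and> word_value w = g"
proof -
  have "g \<in> generate AutT S" using assms generated by simp
  then show ?thesis
  proof (induction rule: generate.induct)
    case one
    show ?case by (intro exI[of _ "[]"]) (simp add: word_value_Nil AutT_simps)
  next
    case (incl h)
    then have "h \<in> carrier AutT" using S_sub carrier_G by auto
    then show ?case using incl by (intro exI[of _ "[h]"]) (simp add: word_value_Nil word_value_Cons AutT_simps)
  next
    case (inv h)
    then have "inv\<^bsub>AutT\<^esub> h \<in> S" using S_inv by blast
    moreover from this have "inv\<^bsub>AutT\<^esub> h \<in> carrier AutT" using S_sub carrier_G by auto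
    ultimately show ?case
      by (intro exI[of _ "[inv\<^bsub>AutT\<^esub> h]"]) (simp add: word_value_Nil word_value_Cons AutT_simps)
  next
    case (eng h1 h2)
    then obtain u v where "set u \<subseteq> S" "word_value u = h1" "set v \<subseteq> S" "word_value v = h2" by blast
    then show ?case by (intro exI[of _ "u @ v"]) (simp add: word_value_append)
  qed
qed

definition word :: "'x tree_map \<Rightarrow> 'x tree_map list" where
  "word g = (SOME w. set w \<subseteq> S \<and> word_value w = g)"

lemma word:
  assumes "g \<in> G"
  shows "set (word g) \<subseteq> S" and "word_value (word g) = g"
  using someI_ex[OF word_exists[OF assms], folded word_def] by blast+

section \<open>Coset representatives and the rewriting tables\<close>

text \<open>The choice sees only the coset, so elements of one coset get the same representative and
  finite index makes the set of values finite.\<close>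

definition rep :: "'x tree_map \<Rightarrow> 'x tree_map" where
  "rep g = (SOME h. h \<in> K #>\<^bsub>AutT\<^esub> g)"

lemma rep:
  assumes "g \<in> G"
  shows "rep g \<in> G" and "g \<otimes>\<^bsub>AutT\<^esub> inv\<^bsub>AutT\<^esub> (rep g) \<in> K"
proof -
  have "g \<in> K #>\<^bsub>AutT\<^esub> g"
    by (rule group.rcos_self[OF group_AutT carrier_G[OF assms] K])
  then have "rep g \<in> K #>\<^bsub>AutT\<^esub> g"
    unfolding rep_def by (rule someI[of "\<lambda>h. h \<in> K #>\<^bsub>AutT\<^esub> g"])
  then obtain k where k: "k \<in> K" "rep g = k \<otimes>\<^bsub>AutT\<^esub> g"
    by (auto simp: r_coset_def)
  then show "rep g \<in> G" using K_sub subgroup.m_closed[OF G] assms by auto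
  have "k \<in> carrier AutT" using k(1) K_sub carrier_G by auto
  then have "g \<otimes>\<^bsub>AutT\<^esub> inv\<^bsub>AutT\<^esub> (rep g) = inv\<^bsub>AutT\<^esub> k"
    unfolding k(2) using carrier_G[OF assms]
    by (metis AutT_simps AutT_assoc group.inv_mult_group[OF group_AutT])
  then show "g \<otimes>\<^bsub>AutT\<^esub> inv\<^bsub>AutT\<^esub> (rep g) \<in> K"
    using k(1) subgroup.m_inv_closed[OF K] by simp
qed

lemma finite_rep: "finite (rep ` G)"
proof -
  have "rep ` G = (\<lambda>C. SOME h. h \<in> C) ` ((\<lambda>g. K #>\<^bsub>AutT\<^esub> g) ` G)"
    by (simp add: rep_def image_image)
  moreover have "(\<lambda>g. K #>\<^bsub>AutT\<^esub> g) ` G = rcosets\<^bsub>AutT\<lparr>carrier := G\<rparr>\<^esub> K"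
    by (auto simp: RCOSETS_def r_coset_def)
  ultimately show ?thesis using index by (simp add: finite_index_def)
qed

text \<open>The identity is added because rewriting starts there, so that no left factor remains
  after telescoping; \<open>rep\<close> may choose another element of K for the trivial
  coset.\<close>

definition reps :: "'x tree_map set" where
  "reps = insert \<one>\<^bsub>AutT\<^esub> (rep ` G)"

lemma reps_in_G: "r \<in> reps \<Longrightarrow> r \<in> G"
  using rep(1) subgroup.one_closed[OF G] by (auto simp: reps_def)

definition nxt :: "'x tree_map \<Rightarrow> 'x tree_map \<Rightarrow> 'x tree_map" where
  "nxt r s = rep (r \<otimes>\<^bsub>AutT\<^esub> s)"

definition inject :: "'x \<Rightarrow> 'x tree_map \<Rightarrow> 'x tree_map" where
  "inject x k = graft id (\<lambda>y. if y = x then k else \<one>\<^bsub>AutT\<^esub>)"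

text \<open>The injected element is the Schreier generator of the edge labelled s that leaves the
  coset of r.\<close>

definition emission :: "'x \<Rightarrow> 'x tree_map \<Rightarrow> 'x tree_map \<Rightarrow> 'x tree_map list" where
  "emission x r s = word (inject x (r \<otimes>\<^bsub>AutT\<^esub> s \<otimes>\<^bsub>AutT\<^esub> inv\<^bsub>AutT\<^esub> (nxt r s)))"

definition child :: "'x tree_map list \<Rightarrow> 'x \<Rightarrow> 'x tree_map" where
  "child rs x = the (map_of (zip xs rs) x)"

text \<open>The graft tested here differs from the element at the node by a left factor in K, so its
  membership in G decides that of the element.\<close>

definition final :: "('x \<Rightarrow> 'x) \<Rightarrow> 'x tree_map list \<Rightarrow> 'x tree_map list option" where
  "final \<sigma> rs = (if graft \<sigma> (child rs) \<in> G then Some (word (graft \<sigma> (child rs))) else None)"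

lemma child_map: "child (map f xs) = f"
  using letters by (simp add: fun_eq_iff child_def map_of_zip_map)

text \<open>Branching realizes the tuple by some element of K that fixes the first level; an
  automorphism is determined by its root permutation and sections, so this element is the graft
  itself.\<close>

lemma graft_in_K:
  assumes "\<And>x. k x \<in> K"
  shows "graft id k \<in> K"
proof -
  have "k \<in> (\<Pi>\<^sub>E x\<in>UNIV. K)" using assms by auto
  then obtain e where e: "e \<in> level1_stabilizer G" "e \<in> K" "Psi e = k" using branch by blast
  then have "e \<in> tree_auts" using K_sub carrier_G by (auto simp: AutT_def)
  then have "e = graft (root_perm e) (\<lambda>x. section_at e [x])" by (rule tree_aut_graft)
  moreover have "root_perm e = id" using e(1) by (auto simp: level1_stabilizer_def root_perm_def)
  moreover have "(\<lambda>x. section_at e [x]) = k" using e(3) by (simp add: Psi_def)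
  ultimately show ?thesis using e(2) by simp
qed

lemma inject_in_K: "k \<in> K \<Longrightarrow> inject x k \<in> K"
  unfolding inject_def using subgroup.one_closed[OF K] by (intro graft_in_K) simp

lemma increment_in_K:
  assumes "r \<in> reps" and "s \<in> S"
  shows "r \<otimes>\<^bsub>AutT\<^esub> s \<otimes>\<^bsub>AutT\<^esub> inv\<^bsub>AutT\<^esub> (nxt r s) \<in> K"
  unfolding nxt_def using assms reps_in_G S_sub by (intro rep subgroup.m_closed[OF G]) auto

lemma emission_word:
  assumes "r \<in> reps" and "s \<in> S"
  shows "set (emission x r s) \<subseteq> S"
    and "word_value (emission x r s) = inject x (r \<otimes>\<^bsub>AutT\<^esub> s \<otimes>\<^bsub>AutT\<^esub> inv\<^bsub>AutT\<^esub> (nxt r s))"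
proof -
  have "inject x (r \<otimes>\<^bsub>AutT\<^esub> s \<otimes>\<^bsub>AutT\<^esub> inv\<^bsub>AutT\<^esub> (nxt r s)) \<in> G"
    using inject_in_K[OF increment_in_K[OF assms]] K_sub by blast
  from word[OF this] show "set (emission x r s) \<subseteq> S"
    and "word_value (emission x r s) = inject x (r \<otimes>\<^bsub>AutT\<^esub> s \<otimes>\<^bsub>AutT\<^esub> inv\<^bsub>AutT\<^esub> (nxt r s))"
    by (simp_all add: emission_def)
qed

lemma nxt_in: "r \<in> reps \<Longrightarrow> s \<in> S \<Longrightarrow> nxt r s \<in> reps"
  unfolding nxt_def reps_def using S_sub reps_in_G[of r] subgroup.m_closed[OF G] by (auto simp: reps_def)

lemma bound_exists:
  "\<exists>L. (\<forall>x r s. r \<in> reps \<longrightarrow> s \<in> S \<longrightarrow> length (emission x r s) \<le> L) \<and>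
    (\<forall>\<sigma> rs f. set rs \<subseteq> reps \<longrightarrow> length rs = length xs \<longrightarrow> final \<sigma> rs = Some f \<longrightarrow> length f \<le> L)"
proof -
  have reps: "finite reps" using finite_rep by (simp add: reps_def)
  let ?A = "(\<lambda>(x, r, s). length (emission x r s)) ` (UNIV \<times> reps \<times> S)"
  let ?B = "(\<lambda>(\<sigma>, rs). length (the (final \<sigma> rs))) ` (UNIV \<times> {rs. set rs \<subseteq> reps \<and> length rs = length xs})"
  have "finite (?A \<union> ?B)"
    using reps finite_S finite_lists_length_eq[OF reps] by simp
  then obtain L where L: "\<And>n. n \<in> ?A \<union> ?B \<Longrightarrow> n \<le> L"
    using finite_nat_set_iff_bounded_le by meson
  have "length (emission x r s) \<le> L" if "r \<in> reps" "s \<in> S" for x r s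
    using that by (intro L) force
  moreover have "length f \<le> L" if "set rs \<subseteq> reps" "length rs = length xs" "final \<sigma> rs = Some f" for \<sigma> rs f
  proof -
    have "length (the (final \<sigma> rs)) \<in> ?B" using that(1,2) by force
    then show ?thesis using L that(3) by simp
  qed
  ultimately show ?thesis by blast
qed

definition L :: nat where
  "L = (SOME L. (\<forall>x r s. r \<in> reps \<longrightarrow> s \<in> S \<longrightarrow> length (emission x r s) \<le> L) \<and>
    (\<forall>\<sigma> rs f. set rs \<subseteq> reps \<longrightarrow> length rs = length xs \<longrightarrow> final \<sigma> rs = Some f \<longrightarrow> length f \<le> L))"

sublocale portrait_machine xs S reps "\<one>\<^bsub>AutT\<^esub>" nxt emission final L
proof
  note L = someI_ex[OF bound_exists, folded L_def]
  show "set (emission x r s) \<subseteq> S \<and> length (emission x r s) \<le> L" if "r \<in> reps" "s \<in> S" for x r s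
    using emission_word(1) that L by blast
  show "set f \<subseteq> S \<and> length f \<le> L"
    if "set rs \<subseteq> reps" "length rs = length xs" "final \<sigma> rs = Some f" for \<sigma> rs f
  proof -
    have "set f \<subseteq> S" using that(3) word(1) by (auto simp: final_def split: if_splits)
    then show ?thesis using that L by blast
  qed
qed (use letters finite_S finite_rep nxt_in in \<open>auto simp: reps_def\<close>)

section \<open>Schreier rewriting and correctness of the evaluation\<close>

lemma inject_mult: "inject x k \<otimes>\<^bsub>AutT\<^esub> inject x l = inject x (k \<otimes>\<^bsub>AutT\<^esub> l)"
proof -
  have "\<one>\<^bsub>AutT\<^esub> \<otimes>\<^bsub>AutT\<^esub> \<one>\<^bsub>AutT\<^esub> = (\<one>\<^bsub>AutT\<^esub> :: 'x tree_map)" by (simp add: AutT_simps)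
  then show ?thesis unfolding inject_def graft_mult by (intro arg_cong[where f = "graft id"]) auto
qed

lemma inject_one: "inject x \<one>\<^bsub>AutT\<^esub> = \<one>\<^bsub>AutT\<^esub>"
  unfolding inject_def if_cancel by (rule graft_one)

lemma telescope:
  assumes "set (s # w) \<subseteq> S" and "r \<in> reps"
  shows "r \<otimes>\<^bsub>AutT\<^esub> word_value (s # w) \<otimes>\<^bsub>AutT\<^esub> inv\<^bsub>AutT\<^esub> (foldl nxt r (s # w)) =
    (r \<otimes>\<^bsub>AutT\<^esub> s \<otimes>\<^bsub>AutT\<^esub> inv\<^bsub>AutT\<^esub> (nxt r s)) \<otimes>\<^bsub>AutT\<^esub>
    (nxt r s \<otimes>\<^bsub>AutT\<^esub> word_value w \<otimes>\<^bsub>AutT\<^esub> inv\<^bsub>AutT\<^esub> (foldl nxt (nxt r s) w))"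
proof -
  have "nxt r s \<in> reps" using assms nxt_in by simp
  moreover have "s \<in> G" using assms S_sub by auto
  ultimately have "r \<in> carrier AutT" "s \<in> carrier AutT" "nxt r s \<in> carrier AutT"
    "word_value w \<in> carrier AutT" "foldl nxt (nxt r s) w \<in> carrier AutT"
    using assms foldl_nxt[of w "nxt r s"] carrier_G reps_in_G word_value_in_G[of w] by auto
  then show ?thesis
    by (simp add: word_value_Cons AutT_assoc AutT_simps AutT_inv_cancel)
qed

text \<open>Schreier rewriting: the increments r s (nxt r s)^-1 telescope, and injecting them at the
  vertex x is a homomorphism.\<close>

lemma value_transduce:
  assumes "set w \<subseteq> S" and "r \<in> reps"
  shows "r \<otimes>\<^bsub>AutT\<^esub> word_value w \<otimes>\<^bsub>AutT\<^esub> inv\<^bsub>AutT\<^esub> (foldl nxt r w) \<in> K"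
    and "word_value (transduce x r w) =
      inject x (r \<otimes>\<^bsub>AutT\<^esub> word_value w \<otimes>\<^bsub>AutT\<^esub> inv\<^bsub>AutT\<^esub> (foldl nxt r w))"
  using assms
proof (induction w arbitrary: r)
  case Nil
  {
    case 1
    then show ?case using carrier_G[OF reps_in_G] subgroup.one_closed[OF K] by (simp add: word_value_Nil AutT_simps)
  next
    case 2
    then show ?case using carrier_G[OF reps_in_G] by (simp add: word_value_Nil inject_one AutT_simps)
  }
next
  case (Cons s w)
  {
    case 1
    then have "s \<in> S" "set w \<subseteq> S" by simp_all
    then show ?case
      unfolding telescope[OF 1]
      using subgroup.m_closed[OF K increment_in_K Cons.IH(1)[OF _ nxt_in]] 1(2) by blast
  next
    case 2
    then have s: "s \<in> S" and w: "set w \<subseteq> S" by simp_all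
    note n = nxt_in[OF 2(2) s]
    show ?case
      unfolding telescope[OF 2]
      using emission_word[OF 2(2) s] length_transduce[OF w n, of x] Cons.IH(2)[OF w n]
      by (simp add: word_value_append inject_mult)
  }
qed

text \<open>Injections at different vertices act on disjoint subtrees. Distinctness makes the
  section of the tail at y trivial, so no vertex receives two factors.\<close>

lemma value_concat_inject:
  assumes "\<And>x. set (v x) \<subseteq> S" and "\<And>x. word_value (v x) = inject x (k x)" and "distinct ys"
  shows "word_value (concat (map v ys)) = graft id (\<lambda>x. if x \<in> set ys then k x else \<one>\<^bsub>AutT\<^esub>)"
  using assms(3)
proof (induction ys)
  case Nil
  show ?case
    by (simp only: list.map concat.simps word_value_Nil list.set empty_iff if_False graft_one)
next
  case (Cons y ys)
  have "word_value (concat (map v (y # ys)))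
      = inject y (k y) \<otimes>\<^bsub>AutT\<^esub> graft id (\<lambda>x. if x \<in> set ys then k x else \<one>\<^bsub>AutT\<^esub>)"
    using Cons assms(1) by (simp add: word_value_append assms(2) UN_subset_iff id_def)
  also have "\<dots> = graft id (\<lambda>x. if x \<in> set (y # ys) then k x else \<one>\<^bsub>AutT\<^esub>)"
    unfolding inject_def graft_mult using Cons.prems
    by (intro arg_cong[where f = "graft id"]) (auto simp: mult_AutT AutT_def)
  finally show ?case .
qed

text \<open>Stated for all automorphisms with a portrait, because sections of an element outside G
  may themselves lie outside G. That a returned word forces membership comes for free, its letters
  being in \<open>S\<close>.\<close>

lemma eval_portrait_correct:
  assumes "nucleus_portrait G g p" and "g \<in> tree_auts"
  shows "set (encode xs p) \<subseteq> tape_symbols \<and>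
    (case eval_portrait p of None \<Rightarrow> g \<notin> G | Some w \<Rightarrow> set w \<subseteq> S \<and> word_value w = g)"
  using assms
proof (induction rule: nucleus_portrait.induct)
  case (leaf g)
  then have g: "g \<in> S" using nucleus by blast
  then have "g \<in> carrier AutT" using S_sub carrier_G by auto
  then show ?case
    using g by (simp add: tape_symbols_def word_value_Cons word_value_Nil AutT_simps)
next
  case (node g c)
  note IH = node.IH[OF section_in_tree_auts[OF node.prems]]
  have enc: "set (encode xs (Node (root_perm g) c)) \<subseteq> tape_symbols"
  proof -
    have "Perm_Label (root_perm g) \<in> tape_symbols" by (simp add: tape_symbols_def)
    moreover have "set (encode xs (c x)) \<subseteq> tape_symbols" for x using IH by blast
    ultimately show ?thesis by (simp add: UN_subset_iff)
  qed
  show ?case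
  proof (cases "\<exists>x. eval_portrait (c x) = None")
    case True
    then obtain x where "eval_portrait (c x) = None" by blast
    with IH[of x] have "section_at g [x] \<notin> G" by simp
    then have "g \<notin> G" using section_in_G by blast
    moreover have "eval_portrait (Node (root_perm g) c) = None"
      unfolding eval_portrait.simps combine_def using True by (rule if_P)
    ultimately show ?thesis using enc by (simp del: eval_portrait.simps encode.simps)
  next
    case False
    define f where "f x = the (eval_portrait (c x))" for x
    have ev: "eval_portrait (c x) = Some (f x)" for x using False by (auto simp: f_def)
    have f: "set (f x) \<subseteq> S" "word_value (f x) = section_at g [x]" for x
      using IH[of x] by (simp_all add: ev)
    define k where "k x = word_value (f x) \<otimes>\<^bsub>AutT\<^esub> inv\<^bsub>AutT\<^esub> (run (f x))" for x
    have one: "\<one>\<^bsub>AutT\<^esub> \<in> reps" by (simp add: reps_def)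
    have fc: "word_value (f x) \<in> carrier AutT" for x using carrier_G[OF word_value_in_G[OF f(1)]] .
    have rc: "run (f x) \<in> carrier AutT" for x using carrier_G[OF reps_in_G[OF run_in[OF f(1)]]] .
    have k: "k x \<in> K" "word_value (transduce x \<one>\<^bsub>AutT\<^esub> (f x)) = inject x (k x)" for x
      using value_transduce(1)[OF f(1)[of x] one] value_transduce(2)[OF f(1)[of x] one, of x] fc[of x] by (simp_all add: k_def run_def AutT_simps)
    have ts: "set (transduce x \<one>\<^bsub>AutT\<^esub> (f x)) \<subseteq> S" for x
      using length_transduce[OF f(1) one] by blast
    define e where "e = graft id k"
    define b where "b = graft (root_perm g) (\<lambda>x. run (f x))"
    have e: "word_value (concat (map (\<lambda>x. transduce x \<one>\<^bsub>AutT\<^esub> (f x)) xs)) = e"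
      using value_concat_inject[OF ts k(2) distinct] letters by (simp add: e_def)
    have "e \<in> K" unfolding e_def using k(1) by (rule graft_in_K)
    then have eG: "e \<in> G" using K_sub by blast
    have "k x \<otimes>\<^bsub>AutT\<^esub> run (f x) = section_at g [x]" for x
      using fc[of x] rc[of x] by (simp add: k_def AutT_assoc AutT_simps f(2)[symmetric])
    then have g: "e \<otimes>\<^bsub>AutT\<^esub> b = g"
      using tree_aut_graft[OF node.prems] by (simp add: e_def b_def graft_mult)
    \<comment> \<open>At this point \<open>b\<close> is not known to be an automorphism, so
      \<open>e\<close> is cancelled by composing maps instead of by the laws of the group.\<close>
    have b: "b \<in> G" if "g \<in> G"
    proof -
      have "b = b \<circ> (e \<circ> inv\<^bsub>AutT\<^esub> e)"
        using group.l_inv[OF group_AutT carrier_G[OF eG]] by (simp add: AutT_def)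
      also have "\<dots> = inv\<^bsub>AutT\<^esub> e \<otimes>\<^bsub>AutT\<^esub> g"
        unfolding g[symmetric] mult_AutT by (simp add: comp_assoc)
      finally show ?thesis
        using that eG subgroup.m_closed[OF G] subgroup.m_inv_closed[OF G] by metis
    qed
    have "eval_portrait (Node (root_perm g) c) =
        (if b \<in> G then Some (concat (map (\<lambda>x. transduce x \<one>\<^bsub>AutT\<^esub> (f x)) xs) @ word b) else None)"
      by (simp add: combine_def ev final_def child_map b_def)
    moreover have "set (concat (map (\<lambda>x. transduce x \<one>\<^bsub>AutT\<^esub> (f x)) xs)) \<subseteq> S" using ts by auto
    moreover have "g \<in> G \<longleftrightarrow> b \<in> G"
      using subgroup.m_closed[OF G eG] g b by blast
    ultimately show ?thesis
      using enc word[of b] e g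
      by (cases "b \<in> G") (simp_all add: word_value_append del: eval_portrait.simps encode.simps set_concat)
  qed
qed

end

theorem theorem5p7:
  fixes G S :: "('x::finite) tree_map set" and xs :: "'x list"
  assumes "distinct xs" and "set xs = UNIV"
    and "contracting G" and "regular_branch G"
    and "finite S" and "\<forall>s\<in>S. inv\<^bsub>AutT\<^esub> s \<in> S"
    and "S \<subseteq> G" and "generate AutT S = G" and "nucleus G \<subseteq> S"
  shows "\<exists>M A B C D. turing_machine M \<and>
    (\<forall>g p. g \<in> contracting_closure G \<longrightarrow> nucleus_portrait G g p \<longrightarrow>
      (if g \<in> G
       then \<exists>w. set w \<subseteq> S \<and> word_value w = g \<and> length w \<le> A * B ^ depth p \<and>
              computes_within M (encode xs p) (Yes # map Generator w) (C * D ^ depth p)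
       else computes_within M (encode xs p) [No] (C * D ^ depth p)))"
proof -
  from assms(4) obtain K where K: "regular_branch_over G K" and "self_similar G"
    by (auto simp: regular_branch_def)
  have "branching G K S xs"
    by (rule branching.intro)
      (use K \<open>self_similar G\<close> assms in \<open>simp_all add: regular_branch_over_def self_similar_def\<close>)
  then interpret branching G K S xs .
  obtain M where M: "turing_machine M"
    and run: "\<And>p. set (encode xs p) \<subseteq> tape_symbols \<Longrightarrow>
      computes_within M (encode xs p)
        (case eval_portrait p of None \<Rightarrow> [No] | Some w \<Rightarrow> Yes # map Generator w)
        (9 * (time_growth + length xs + 1) ^ depth p)"
    using machine_exists by blast
  \<comment> \<open>The constants are A = 1, B = \<open>growth\<close> and C = 9; all bases are
    fixed by the data of the locale and do not depend on g or p.\<close>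
  have "if g \<in> G
       then \<exists>w. set w \<subseteq> S \<and> word_value w = g \<and> length w \<le> 1 * growth ^ depth p \<and>
              computes_within M (encode xs p) (Yes # map Generator w)
                (9 * (time_growth + length xs + 1) ^ depth p)
       else computes_within M (encode xs p) [No] (9 * (time_growth + length xs + 1) ^ depth p)"
    if "g \<in> contracting_closure G" and p: "nucleus_portrait G g p" for g p
  proof -
    have "g \<in> tree_auts" using that(1) by (simp add: contracting_closure_def)
    note correct = eval_portrait_correct[OF p this]
    note bound = eval_portrait_bound[OF conjunct1[OF correct] order_refl]
    show ?thesis
    proof (cases "eval_portrait p")
      case None
      then show ?thesis using correct run[of p] by simp
    next
      case (Some w)
      then have w: "set w \<subseteq> S" "word_value w = g" using correct by auto
      then have "g \<in> G" using word_value_in_G by blast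
      then show ?thesis using correct run[of p] bound[OF Some] w Some by auto
    qed
  qed
  with M show ?thesis by blast
qed

end
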